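(* In the QC setting described in the context, for every (deterministic) initial condition $\mathbf{x}(0)\in\mathbb{R}^N$, $$\mathbb{P}\Big[\lim_{i\to\infty}\rho\big(\mathbf{x}(i),\mathcal{C}\big)=0\Big]=1,$$ where $\rho(\mathbf{x},\mathcal{C})=\inf_{\mathbf{y}\in\mathcal{C}}\|\mathbf{x}-\mathbf{y}\|$ is the Euclidean distance to the consensus subspace $\mathcal{C}=\{a\mathbf{1}:a\in\mathbb{R}\}$.
   Context: QC setting. Let $N\ge 2$; all random objects live on one probability space. $\{L(i)\}_{i\ge0}$ is an i.i.d. sequence of random graph Laplacians $L(i)=D(i)-A(i)$, where $A(i)$ is the adjacency matrix (symmetric, $\{0,1\}$-valued, zero diagonal) of a random undirected simple graph on $\{1,\dots,N\}$, $D(i)=\mathrm{diag}(d_1(i),\dots,d_N(i))$ with $d_n(i)$ the degree of node $n$, and $\Omega_n(i)=\{l:A_{nl}(i)=1\}$. Link failures at a given time may be arbitrarily correlated across edges. Let $\overline{L}=\mathbb{E}[L(i)]$ with eigenvalues $0=\lambda_1(\overline{L})\le\lambda_2(\overline{L})\le\cdots\le\lambda_N(\overline{L})$; assume $\lambda_2(\overline{L})>0$. $\mathcal{M}$ denotes the set of realizable edges (those appearing in the random graph with positive probability). Quantizer: step $\Delta>0$, $q(y)=k\Delta$ if $(k-\tfrac12)\Delta\le y<(k+\tfrac12)\Delta$, $k\in\mathbb{Z}$. Dither: $\{\nu_{nl}(i)\}_{i\ge0,1\le n,l\le N}$ i.i.d. uniform on $[-\Delta/2,\Delta/2)$, independent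 of $\{L(i)\}$. Weights: deterministic $\alpha(i)>0$ with $\sum_i\alpha(i)=\infty$, $\sum_i\alpha^2(i)<\infty$. QC recursion: $x_n(i+1)=(1-\alpha(i)d_n(i))x_n(i)+\alpha(i)\sum_{l\in\Omega_n(i)}q(x_l(i)+\nu_{nl}(i))$, $1\le n\le N$. With $\varepsilon_{nl}(i)=q(x_l(i)+\nu_{nl}(i))-(x_l(i)+\nu_{nl}(i))$, $\Upsilon_n(i)=-\sum_{l\in\Omega_n(i)}\nu_{nl}(i)$, $\Psi_n(i)=-\sum_{l\in\Omega_n(i)}\varepsilon_{nl}(i)$, this reads $\mathbf{x}(i+1)=\mathbf{x}(i)-\alpha(i)[L(i)\mathbf{x}(i)+\Upsilon(i)+\Psi(i)]$. By the standard property of uniformly dithered quantization, conditionally on $\mathbf{x}(0),\{L(j),\Upsilon(j),\Psi(j)\}_{j<i}$ and $L(i)$, the $\varepsilon_{nl}(i)$ are i.i.d. uniform on $[-\Delta/2,\Delta/2)$ (as are the $\nu_{nl}(i)$). *)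

theory Defs
  imports "HOL-Probability.Probability" "Jordan_Normal_Form.Char_Poly"
begin

text \<open>Nodes are 0..<N. A random graph at time i, outcome w, is the adjacency
 relation A i w :: nat => nat => bool (A i w n l means edge {n,l}).\<close>

definition degree_g :: "nat \<Rightarrow> (nat \<Rightarrow> nat \<Rightarrow> bool) \<Rightarrow> nat \<Rightarrow> real" where
  "degree_g N Adj n = real (card {l. l < N \<and> Adj n l})"

definition laplacian_entry :: "nat \<Rightarrow> (nat \<Rightarrow> nat \<Rightarrow> bool) \<Rightarrow> nat \<Rightarrow> nat \<Rightarrow> real" where
  "laplacian_entry N Adj n l = (if n = l then degree_g N Adj n else 0) - (if Adj n l then 1 else 0)"

text \<open>Eigenvalues (with multiplicity) of a real matrix, in increasing order:
 real roots of the characteristic polynomial. For the symmetric matrices used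
 here the characteristic polynomial splits over the reals.\<close>
definition sorted_eigenvalues :: "real mat \<Rightarrow> real list" where
  "sorted_eigenvalues L = sorted_list_of_multiset (proots (char_poly L))"

definition lambda2 :: "real mat \<Rightarrow> real" where
  "lambda2 L = sorted_eigenvalues L ! 1"

text \<open>Uniform quantizer with step Delta: q y = k*Delta iff (k-1/2)Delta <= y < (k+1/2)Delta.\<close>
definition quant :: "real \<Rightarrow> real \<Rightarrow> real" where
  "quant \<Delta> y = \<Delta> * of_int \<lfloor>y / \<Delta> + 1/2\<rfloor>"

primrec qc_state :: "nat \<Rightarrow> real \<Rightarrow> (nat \<Rightarrow> real) \<Rightarrow> (nat \<Rightarrow> 'w \<Rightarrow> nat \<Rightarrow> nat \<Rightarrow> bool)
   \<Rightarrow> (nat \<Rightarrow> 'w \<Rightarrow> nat \<Rightarrow> nat \<Rightarrow> real) \<Rightarrow> (nat \<Rightarrow> real) \<Rightarrow> nat \<Rightarrow> 'w \<Rightarrow> nat \<Rightarrow> real" where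
  "qc_state N \<Delta> \<alpha> A \<nu> x0 0 w = x0"
| "qc_state N \<Delta> \<alpha> A \<nu> x0 (Suc i) w = (\<lambda>n.
      (1 - \<alpha> i * degree_g N (A i w) n) * qc_state N \<Delta> \<alpha> A \<nu> x0 i w n
      + \<alpha> i * (\<Sum>l\<in>{l. l < N \<and> A i w n l}. quant \<Delta> (qc_state N \<Delta> \<alpha> A \<nu> x0 i w l + \<nu> i w n l)))"

definition dist_consensus :: "nat \<Rightarrow> (nat \<Rightarrow> real) \<Rightarrow> real" where
  "dist_consensus N x = (INF a::real. sqrt (\<Sum>n<N. (x n - a)\<^sup>2))"

end

theory Submission
  imports Defs
begin

text \<open>The spread \<open>S(x) = \<Sum>\<^sub>n\<^sub>l (x\<^sub>n - x\<^sub>l)\<^sup>2\<close> (which is \<open>2N\<close> times the squared distance to consensus)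
  is a Lyapunov function. Put \<open>\<epsilon>\<^sub>n\<^sub>l = q(x\<^sub>l + \<nu>\<^sub>n\<^sub>l) - x\<^sub>l\<close>: uniform dithering makes it bounded with zero mean
  given the past and the current graph. One step of the recursion changes \<open>S\<close> by
  \<open>-2\<alpha>N \<Sum> A\<^sub>n\<^sub>l (x\<^sub>n - x\<^sub>l)\<^sup>2\<close>, a term linear in \<open>\<epsilon>\<close>, and an error \<open>O(\<alpha>\<^sup>2 (S + 1))\<close>. In conditional
  mean the first is at most \<open>-c \<alpha> S\<close>, because \<open>\<lambda>\<^sub>2 > 0\<close> forces the graph of realizable edges to be connected;
  the second vanishes. After normalisation \<open>S\<close> becomes a nonnegative supermartingale whose mean comes
  arbitrarily close to \<open>0\<close> since \<open>\<Sum>\<alpha> = \<infinity>\<close>, and the maximal inequality turns this into almost sure convergence.\<close>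

subsection \<open>Almost sure convergence of nonnegative supermartingales\<close>

text \<open>Conditioning on the past is expressed by testing against \<open>indicator B\<close> for
  every event \<open>B\<close> of the past sigma-algebra, so a conditional inequality becomes a
  family of inequalities between integrals. The main obstacle is that the error is a nonlinear
  function of state and dither and is centred only when the state is frozen. Hence joint
  independence of all graphs and dithers is assembled from the three separate independence
  hypotheses, and Fubini does the freezing. Connectivity comes by contraposition: a cut crossed by
  no realizable edge puts the indicator vectors of both sides into the kernel of the mean Laplacian,
  so 0 is a double root of its characteristic polynomial. Connectivity is then used only to produce
  some positive constant in a Poincare inequality weighted by the link probabilities. The
  normalisation divides by the product of the factors \<open>1 + b * (\<alpha> j)\<^sup>2\<close>
  and adds the tail of the additive noise; the square summability of the weights keeps the product
  bounded and sends the tail to 0.\<close>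

text \<open>The process is watched from time \<open>n\<close> until it reaches
  \<open>\<epsilon>\<close>: the event of not having reached it loses mass only where the current
  value is at least \<open>\<epsilon>\<close>, and the integral over the remaining part cannot
  grow.\<close>

lemma (in prob_space) supermartingale_maximal_inequality:
  fixes W :: "nat \<Rightarrow> 'a \<Rightarrow> real"
  assumes sub: "\<And>i. subalgebra M (F i)" and mono: "\<And>i. sets (F i) \<subseteq> sets (F (Suc i))"
    and meas: "\<And>i. W i \<in> borel_measurable (F i)" and int: "\<And>i. integrable M (W i)"
    and nonneg: "\<And>i w. 0 \<le> W i w"
    and step: "\<And>i B. B \<in> sets (F i) \<Longrightarrow>
      (\<integral>w. W (Suc i) w * indicator B w \<partial>M) \<le> (\<integral>w. W i w * indicator B w \<partial>M)"
    and "0 < \<epsilon>"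
  shows "\<epsilon> * prob {w \<in> space M. \<exists>i\<ge>n. \<epsilon> \<le> W i w} \<le> expectation (W n)"
proof -
  have FM: "B \<in> events" if "B \<in> sets (F i)" for B i
    using sub[of i] that by (auto simp: subalgebra_def)
  have sp: "space (F i) = space M" for i
    using sub[of i] by (auto simp: subalgebra_def)
  have measM [measurable]: "W i \<in> borel_measurable M" for i
    using int by auto
  \<comment> \<open>The range is half-open so that \<open>B (Suc k)\<close>, which involves
    \<open>W\<close> only up to time \<open>k\<close>, is an event of \<open>F k\<close>;
    \<open>step\<close> is applied to it at time \<open>k\<close>.\<close>
  define B where "B k = {w \<in> space M. \<forall>i\<in>{n..<k}. W i w < \<epsilon>}" for k
  have BSuc: "B (Suc k) = {w \<in> space (F k). W k w < \<epsilon>} \<inter> B k" if "n \<le> k" for k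
    using that by (auto simp: B_def sp less_Suc_eq)
  have BF: "B k \<in> sets (F k)" "B (Suc k) \<in> sets (F k)" if "n \<le> k" for k
  proof -
    have "B k \<in> sets (F k)"
      using that
    proof (induction k rule: nat_induct_at_least)
      case base
      have "B n = space (F n)" by (auto simp: B_def sp)
      then show ?case by simp
    next
      case (Suc k)
      have "{w \<in> space (F k). W k w < \<epsilon>} \<in> sets (F k)"
        using meas[of k] by measurable
      then have "B (Suc k) \<in> sets (F k)"
        unfolding BSuc[OF Suc.hyps] using Suc.IH by auto
      then show ?case using mono by blast
    qed
    moreover have "{w \<in> space (F k). W k w < \<epsilon>} \<in> sets (F k)"
      using meas[of k] by measurable
    ultimately show "B k \<in> sets (F k)" "B (Suc k) \<in> sets (F k)"
      unfolding BSuc[OF that] by auto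
  qed
  have intI: "integrable M (\<lambda>w. c * indicator C w)" if "C \<in> events" for c :: real and C
    using integrable_mult_indicator[OF that, of "\<lambda>_. c"] by (simp add: mult.commute)
  have intB: "integrable M (\<lambda>w. W i w * indicator C w)" if "C \<in> events" for i C
    using integrable_mult_indicator[OF that int[of i]] by (simp add: mult.commute)
  \<comment> \<open>On \<open>B k - B (Suc k)\<close> one has \<open>\<epsilon> \<le> W k\<close>,
    so the integral of \<open>W k\<close> over that set pays for the growth of the second term; on
    \<open>B (Suc k)\<close> the hypothesis \<open>step\<close> passes from \<open>W k\<close> to
    \<open>W (Suc k)\<close>.\<close>
  have bound: "(\<integral>w. W k w * indicator (B k) w \<partial>M) + \<epsilon> * (1 - prob (B k)) \<le> expectation (W n)"
    if "n \<le> k" for k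
    using that
  proof (induction k rule: nat_induct_at_least)
    case base
    have "B n = space M" by (auto simp: B_def)
    then show ?case by (simp add: prob_space cong: Bochner_Integration.integral_cong)
  next
    case (Suc k)
    note Bev = FM[OF BF(1)[OF Suc.hyps]] FM[OF BF(2)[OF Suc.hyps]]
    have sub': "B (Suc k) \<subseteq> B k" using BSuc[OF Suc.hyps] by auto
    have "(\<integral>w. W (Suc k) w * indicator (B (Suc k)) w \<partial>M) + \<epsilon> * (prob (B k) - prob (B (Suc k)))
        \<le> (\<integral>w. W k w * indicator (B (Suc k)) w \<partial>M) + \<epsilon> * prob (B k - B (Suc k))"
      using step[OF BF(2)[OF Suc.hyps]] finite_measure_Diff[OF Bev sub'] by simp
    also have "\<dots> = (\<integral>w. W k w * indicator (B (Suc k)) w + \<epsilon> * indicator (B k - B (Suc k)) w \<partial>M)"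
      using Bev intB intI by (subst Bochner_Integration.integral_add) auto
    also have "\<dots> \<le> (\<integral>w. W k w * indicator (B k) w \<partial>M)"
    proof (rule integral_mono)
      show "integrable M (\<lambda>w. W k w * indicator (B (Suc k)) w + \<epsilon> * indicator (B k - B (Suc k)) w)"
        by (intro Bochner_Integration.integrable_add intB intI sets.Diff Bev)
      show "W k w * indicator (B (Suc k)) w + \<epsilon> * indicator (B k - B (Suc k)) w \<le> W k w * indicator (B k) w"
        if "w \<in> space M" for w
        using that nonneg BSuc[OF Suc.hyps] by (auto simp: indicator_def sp)
    qed (use Bev intB in auto)
    finally show ?case using Suc.IH by (simp add: algebra_simps)
  qed
  have "\<epsilon> * prob (space M - B k) \<le> expectation (W n)" if "n \<le> k" for k
  proof -
    have "0 \<le> (\<integral>w. W k w * indicator (B k) w \<partial>M)"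
      by (rule integral_nonneg_AE) (auto simp: nonneg)
    then show ?thesis
      using bound[OF that] prob_compl[OF FM[OF BF(1)[OF that]]] by simp
  qed
  moreover have "(\<lambda>k. \<epsilon> * prob (space M - B (n + k))) \<longlonglongrightarrow> \<epsilon> * prob (\<Union>k. space M - B (n + k))"
    by (intro tendsto_mult tendsto_const finite_Lim_measure_incseq)
       (auto simp: incseq_def B_def intro!: FM[OF BF(1)])
  ultimately have "\<epsilon> * prob (\<Union>k. space M - B (n + k)) \<le> expectation (W n)"
    by (intro LIMSEQ_le_const2) auto
  also have "(\<Union>k. space M - B (n + k)) = {w \<in> space M. \<exists>i\<ge>n. \<epsilon> \<le> W i w}"
  proof (intro equalityI subsetI)
    fix w assume "w \<in> {w \<in> space M. \<exists>i\<ge>n. \<epsilon> \<le> W i w}"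
    then obtain i where "w \<in> space M" "n \<le> i" "\<epsilon> \<le> W i w" by blast
    then have "w \<in> space M - B (n + Suc i)" by (auto simp: B_def not_less intro!: bexI[of _ i])
    then show "w \<in> (\<Union>k. space M - B (n + k))" by blast
  qed (auto simp: B_def not_less)
  finally show ?thesis .
qed

text \<open>A single time with small mean is enough, because the maximal inequality started there
  controls all later times at once. The limit is thereby identified as 0 together with its
  existence.\<close>

lemma (in prob_space) supermartingale_tendsto_zero:
  fixes W :: "nat \<Rightarrow> 'a \<Rightarrow> real"
  assumes sub: "\<And>i. subalgebra M (F i)" and mono: "\<And>i. sets (F i) \<subseteq> sets (F (Suc i))"
    and meas: "\<And>i. W i \<in> borel_measurable (F i)" and int: "\<And>i. integrable M (W i)"
    and nonneg: "\<And>i w. 0 \<le> W i w"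
    and step: "\<And>i B. B \<in> sets (F i) \<Longrightarrow>
      (\<integral>w. W (Suc i) w * indicator B w \<partial>M) \<le> (\<integral>w. W i w * indicator B w \<partial>M)"
    and small: "\<And>\<delta>. 0 < \<delta> \<Longrightarrow> \<exists>n. expectation (W n) < \<delta>"
  shows "AE w in M. (\<lambda>i. W i w) \<longlonglongrightarrow> 0"
proof -
  have measM [measurable]: "W i \<in> borel_measurable M" for i
    using int by auto
  have ev: "AE w in M. \<exists>n. \<forall>i\<ge>n. W i w < \<epsilon>" if "0 < \<epsilon>" for \<epsilon>
  proof (rule AE_I)
    let ?S = "{w \<in> space M. \<not> (\<exists>n. \<forall>i\<ge>n. W i w < \<epsilon>)}"
    show "?S \<in> events" by measurable
    have "prob ?S \<le> 0"
    proof (rule field_le_epsilon)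
      fix \<delta> :: real assume "0 < \<delta>"
      then obtain n where n: "expectation (W n) < \<epsilon> * \<delta>"
        using small[of "\<epsilon> * \<delta>"] \<open>0 < \<epsilon>\<close> by auto
      have "prob ?S \<le> prob {w \<in> space M. \<exists>i\<ge>n. \<epsilon> \<le> W i w}"
      proof (rule finite_measure_mono)
        show "{w \<in> space M. \<exists>i\<ge>n. \<epsilon> \<le> W i w} \<in> events" by measurable
      qed (auto simp: not_less)
      then have "\<epsilon> * prob ?S \<le> \<epsilon> * prob {w \<in> space M. \<exists>i\<ge>n. \<epsilon> \<le> W i w}"
        using that by simp
      also have "\<dots> \<le> \<epsilon> * \<delta>"
        using supermartingale_maximal_inequality[where F = F and W = W and \<epsilon> = \<epsilon> and n = n,
            OF sub mono meas int nonneg step that] n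
        by linarith
      finally show "prob ?S \<le> 0 + \<delta>" using that by simp
    qed
    then have "prob ?S = 0" using measure_nonneg[of M ?S] by linarith
    then show "emeasure M ?S = 0" by (simp add: emeasure_eq_measure)
  qed auto
  have "AE w in M. \<forall>k. \<exists>n. \<forall>i\<ge>n. W i w < inverse (real (Suc k))"
    unfolding AE_all_countable by (intro allI ev) simp
  then show ?thesis
  proof eventually_elim
    case (elim w)
    show ?case
    proof (rule LIMSEQ_I)
      fix r :: real assume "0 < r"
      then obtain k where "inverse (real (Suc k)) < r" using reals_Archimedean by blast
      moreover obtain n where "\<forall>i\<ge>n. W i w < inverse (real (Suc k))" using elim by blast
      ultimately show "\<exists>n. \<forall>i\<ge>n. norm (W i w - 0) < r"
        using nonneg[of _ w] by (intro exI[of _ n]) (fastforce)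
    qed
  qed
qed

text \<open>Were \<open>v\<close> at least \<open>\<delta>\<close> from \<open>n\<close> on, every
  step would remove at least \<open>a * \<delta> * \<alpha> i\<close>. The removals have infinite
  sum and the additions \<open>e\<close> a finite one, which contradicts
  \<open>0 \<le> v\<close>.\<close>

lemma contracting_sequence_small:
  fixes v \<alpha> :: "nat \<Rightarrow> real"
  assumes step: "\<And>i. v (Suc i) \<le> v i - a * \<alpha> i * v i + e i"
    and pos: "\<And>i. 0 < \<alpha> i" "0 < a" and v: "\<And>i. 0 \<le> v i"
    and nsum: "\<not> summable \<alpha>" and e: "summable e" "\<And>i. 0 \<le> e i" and "0 < \<delta>"
  shows "\<exists>m\<ge>n. v m < \<delta>"
proof (rule ccontr)
  assume "\<not> (\<exists>m\<ge>n. v m < \<delta>)"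
  then have big: "\<delta> \<le> v (n + m)" for m by (auto simp: not_less)
  have sums: "v (n + m) + a * \<delta> * (\<Sum>i<m. \<alpha> (n + i)) \<le> v n + (\<Sum>i<m. e (n + i))" for m
  proof (induction m)
    case (Suc m)
    have "a * \<alpha> (n + m) * \<delta> \<le> a * \<alpha> (n + m) * v (n + m)"
      using big[of m] pos by (intro mult_left_mono) (auto simp: less_imp_le)
    then show ?case using Suc step[of "n + m"] by (simp add: algebra_simps)
  qed simp
  have "a * \<delta> * (\<Sum>i<m. \<alpha> (n + i)) \<le> v n + (\<Sum>i. e (n + i))" for m
  proof -
    have "a * \<delta> * (\<Sum>i<m. \<alpha> (n + i)) \<le> v (n + m) + a * \<delta> * (\<Sum>i<m. \<alpha> (n + i))"
      using v by simp
    also note sums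
    also have "(\<Sum>i<m. e (n + i)) \<le> (\<Sum>i. e (n + i))"
      using e summable_iff_shift[of e n] by (intro sum_le_suminf) (auto simp: add.commute)
    finally show ?thesis by simp
  qed
  then have "(\<Sum>i<m. \<alpha> (n + i)) \<le> (v n + (\<Sum>i. e (n + i))) / (a * \<delta>)" for m
    using pos \<open>0 < \<delta>\<close> by (simp add: pos_le_divide_eq mult.commute)
  then have "(\<Sum>i\<le>m. \<alpha> (n + i)) \<le> (v n + (\<Sum>i. e (n + i))) / (a * \<delta>)" for m
    unfolding lessThan_Suc_atMost[symmetric] .
  then have "summable (\<lambda>i. \<alpha> (n + i))"
    by (rule bounded_imp_summable[rotated]) (use pos(1) in \<open>simp add: less_imp_le\<close>)
  then show False using nsum summable_iff_shift[of \<alpha> n] by (simp add: add.commute)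
qed

text \<open>\<open>P\<close> absorbs the multiplicative growth and the tail \<open>T\<close> the
  additive noise, so \<open>V / P + T\<close> is a supermartingale even after the negative drift is
  dropped. The drift serves to make the means small.\<close>

lemma (in prob_space) robbins_siegmund_tendsto_zero:
  fixes V :: "nat \<Rightarrow> 'a \<Rightarrow> real" and \<alpha> :: "nat \<Rightarrow> real"
  assumes sub: "\<And>i. subalgebra M (F i)" and mono: "\<And>i. sets (F i) \<subseteq> sets (F (Suc i))"
    and meas: "\<And>i. V i \<in> borel_measurable (F i)" and int: "\<And>i. integrable M (V i)"
    and nonneg: "\<And>i w. 0 \<le> V i w"
    and step: "\<And>i B. B \<in> sets (F i) \<Longrightarrow> (\<integral>w. V (Suc i) w * indicator B w \<partial>M)
      \<le> (1 - a * \<alpha> i + b * (\<alpha> i)\<^sup>2) * (\<integral>w. V i w * indicator B w \<partial>M) + d * (\<alpha> i)\<^sup>2 * prob B"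
    and cpos: "0 < a" "0 \<le> b" "0 \<le> d"
    and pos: "\<And>i. 0 < \<alpha> i" and nsum: "\<not> summable \<alpha>" and sq: "summable (\<lambda>i. (\<alpha> i)\<^sup>2)"
  shows "AE w in M. (\<lambda>i. V i w) \<longlonglongrightarrow> 0"
proof -
  define P where "P i = (\<Prod>j<i. 1 + b * (\<alpha> j)\<^sup>2)" for i
  define T where "T i = d * ((\<Sum>j. (\<alpha> j)\<^sup>2) - (\<Sum>j<i. (\<alpha> j)\<^sup>2))" for i
  define W where "W i w = V i w / P i + T i" for i w
  \<comment> \<open>Bounds every \<open>P i\<close>, by \<open>1 + x \<le> exp x\<close>.\<close>
  define K where "K = exp (b * (\<Sum>j. (\<alpha> j)\<^sup>2))"
  have sumle: "(\<Sum>j<i. (\<alpha> j)\<^sup>2) \<le> (\<Sum>j. (\<alpha> j)\<^sup>2)" for i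
    using sq by (intro sum_le_suminf) auto
  have P1: "1 \<le> P i" for i
    unfolding P_def using cpos by (intro prod_ge_1) auto
  have PK: "P i \<le> K" for i
  proof -
    have "P i \<le> (\<Prod>j<i. exp (b * (\<alpha> j)\<^sup>2))"
      unfolding P_def using cpos by (intro prod_mono) (auto simp: exp_ge_add_one_self)
    also have "\<dots> = exp (b * (\<Sum>j<i. (\<alpha> j)\<^sup>2))"
      by (simp add: exp_sum sum_distrib_left)
    also have "\<dots> \<le> K"
      unfolding K_def using sumle cpos by (simp add: mult_left_mono)
    finally show ?thesis .
  qed
  have T0: "0 \<le> T i" for i using sumle[of i] cpos by (simp add: T_def)
  have TS: "T i = T (Suc i) + d * (\<alpha> i)\<^sup>2" for i by (simp add: T_def algebra_simps)
  have Tlim: "T \<longlonglongrightarrow> 0"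
    using summable_LIMSEQ[OF sq] unfolding T_def
    by (auto intro!: tendsto_eq_intros)
  have FM: "B \<in> events" if "B \<in> sets (F i)" for B i
    using sub[of i] that by (auto simp: subalgebra_def)
  have intI: "integrable M (\<lambda>w. c * indicator C w)" if "C \<in> events" for c :: real and C
    using integrable_mult_indicator[OF that, of "\<lambda>_. c"] by (simp add: mult.commute)
  have intB: "integrable M (\<lambda>w. V i w * indicator C w)" if "C \<in> events" for i C
    using integrable_mult_indicator[OF that int[of i]] by (simp add: mult.commute)
  have WB: "(\<integral>w. W i w * indicator B w \<partial>M) = (\<integral>w. V i w * indicator B w \<partial>M) / P i + T i * prob B"
    if "B \<in> events" for i B
  proof -
    have "(\<integral>w. W i w * indicator B w \<partial>M)
        = (\<integral>w. (V i w * indicator B w) / P i + T i * indicator B w \<partial>M)"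
      by (intro Bochner_Integration.integral_cong) (auto simp: W_def field_simps)
    also have "\<dots> = (\<integral>w. V i w * indicator B w \<partial>M) / P i + T i * prob B"
      using that intB intI by (subst Bochner_Integration.integral_add) auto
    finally show ?thesis .
  qed
  have "AE w in M. (\<lambda>i. W i w) \<longlonglongrightarrow> 0"
  proof (rule supermartingale_tendsto_zero[where F = F and W = W, OF sub mono])
    show "W i \<in> borel_measurable (F i)" for i unfolding W_def using meas by measurable
    show "integrable M (W i)" for i unfolding W_def using int by auto
    show "0 \<le> W i w" for i w unfolding W_def using nonneg[of i w] T0[of i] P1[of i] by auto
    show "(\<integral>w. W (Suc i) w * indicator B w \<partial>M) \<le> (\<integral>w. W i w * indicator B w \<partial>M)"
      if B: "B \<in> sets (F i)" for i B
    proof -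
      let ?I = "\<lambda>i. \<integral>w. V i w * indicator B w \<partial>M"
      have I0: "0 \<le> ?I i" by (rule integral_nonneg_AE) (auto simp: nonneg)
      have PS: "P (Suc i) = P i * (1 + b * (\<alpha> i)\<^sup>2)" by (simp add: P_def)
      have q: "0 < 1 + b * (\<alpha> i)\<^sup>2" using cpos by (simp add: add_pos_nonneg)
      have "- (a * \<alpha> i) * ?I i \<le> 0" using cpos pos[of i] I0 by simp
      then have "?I (Suc i) \<le> (1 + b * (\<alpha> i)\<^sup>2) * ?I i + d * (\<alpha> i)\<^sup>2 * prob B"
        using step[OF B] by (simp add: algebra_simps)
      then have "?I (Suc i) / P (Suc i) \<le> ((1 + b * (\<alpha> i)\<^sup>2) * ?I i + d * (\<alpha> i)\<^sup>2 * prob B) / P (Suc i)"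
        using P1[of "Suc i"] by (intro divide_right_mono) auto
      also have "\<dots> = ?I i / P i + d * (\<alpha> i)\<^sup>2 * prob B / P (Suc i)"
        using q P1[of i] by (simp add: PS add_divide_distrib)
      also have "\<dots> \<le> ?I i / P i + d * (\<alpha> i)\<^sup>2 * prob B"
        using P1[of "Suc i"] cpos mult_left_mono[of 1 "P (Suc i)" "d * (\<alpha> i)\<^sup>2 * prob B"]
        by (auto simp: divide_le_eq)
      finally show ?thesis
        unfolding WB[OF FM[OF B]] using TS[of i] by (simp add: algebra_simps)
    qed
    fix \<delta> :: real assume "0 < \<delta>"
    define v where "v i = expectation (V i)" for i
    have vB: "(\<integral>w. V i w * indicator (space M) w \<partial>M) = v i" for i
      unfolding v_def by (intro Bochner_Integration.integral_cong) auto
    have v0: "0 \<le> v i" for i unfolding v_def by (rule integral_nonneg_AE) (auto simp: nonneg)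
    have EW: "expectation (W i) = v i / P i + T i" for i
      unfolding W_def v_def using int by (simp add: prob_space)
    have vstep: "v (Suc i) \<le> (1 - a * \<alpha> i + b * (\<alpha> i)\<^sup>2) * v i + d * (\<alpha> i)\<^sup>2" for i
    proof -
      have "space M \<in> sets (F i)"
        using sets.top[of "F i"] sub[of i] unfolding subalgebra_def by metis
      then show ?thesis using step[of "space M" i] by (simp add: vB prob_space)
    qed
    have bnd: "v i / P i + T i \<le> v 0 + T 0" for i
    proof (induction i)
      case (Suc i)
      have PS: "P (Suc i) = P i * (1 + b * (\<alpha> i)\<^sup>2)" by (simp add: P_def)
      have q: "0 < 1 + b * (\<alpha> i)\<^sup>2" using cpos by (simp add: add_pos_nonneg)
      have "- (a * \<alpha> i) * v i \<le> 0" using cpos pos[of i] v0 by simp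
      then have "v (Suc i) \<le> (1 + b * (\<alpha> i)\<^sup>2) * v i + d * (\<alpha> i)\<^sup>2"
        using vstep[of i] by (simp add: algebra_simps)
      then have "v (Suc i) / P (Suc i) \<le> ((1 + b * (\<alpha> i)\<^sup>2) * v i + d * (\<alpha> i)\<^sup>2) / P (Suc i)"
        using P1[of "Suc i"] by (intro divide_right_mono) auto
      also have "\<dots> = v i / P i + d * (\<alpha> i)\<^sup>2 / P (Suc i)"
        using q P1[of i] by (simp add: PS add_divide_distrib)
      also have "\<dots> \<le> v i / P i + d * (\<alpha> i)\<^sup>2"
        using P1[of "Suc i"] cpos mult_left_mono[of 1 "P (Suc i)" "d * (\<alpha> i)\<^sup>2"]
        by (auto simp: divide_le_eq)
      finally show ?case using TS[of i] Suc by simp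
    qed (simp add: P_def)
    \<comment> \<open>A bound on all means \<open>v i\<close> at once turns the multiplicative term
      \<open>b * (\<alpha> i)\<^sup>2 * v i\<close> into a summable additive one, which is the form
      that \<open>contracting_sequence_small\<close> accepts.\<close>
    define C where "C = K * (v 0 + T 0)"
    have C: "v i \<le> C" for i
    proof -
      have "v i / P i \<le> v 0 + T 0" using bnd[of i] T0[of i] by simp
      then have "v i \<le> P i * (v 0 + T 0)"
        using P1[of i] by (simp add: divide_le_eq mult.commute)
      also have "\<dots> \<le> C" unfolding C_def using PK v0 T0 by (intro mult_right_mono) auto
      finally show ?thesis .
    qed
    have C0: "0 \<le> C" using C[of 0] v0[of 0] by linarith
    \<comment> \<open>Half of \<open>\<delta>\<close> goes to the tail. The time \<open>m\<close> at
      which the mean is small must lie beyond this \<open>n\<close>, so that both halves hold at the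
      same time.\<close>
    obtain n where n: "T m < \<delta> / 2" if "n \<le> m" for m
      using order_tendstoD(2)[OF Tlim, of "\<delta> / 2"] \<open>0 < \<delta>\<close> unfolding eventually_sequentially by auto
    have "\<exists>m\<ge>n. v m < \<delta> / 2"
    proof (rule contracting_sequence_small[where a = a and \<alpha> = \<alpha> and e = "\<lambda>i. (b * C + d) * (\<alpha> i)\<^sup>2"])
      fix i
      have "b * (\<alpha> i)\<^sup>2 * v i \<le> b * (\<alpha> i)\<^sup>2 * C" using C cpos by (intro mult_left_mono) auto
      then show "v (Suc i) \<le> v i - a * \<alpha> i * v i + (b * C + d) * (\<alpha> i)\<^sup>2"
        using vstep[of i] by (simp add: algebra_simps)
    qed (use v0 pos cpos nsum sq C0 \<open>0 < \<delta>\<close> in \<open>auto intro!: summable_mult\<close>)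
    then obtain m where m: "n \<le> m" "v m < \<delta> / 2" by auto
    have "v m / P m \<le> v m" using P1[of m] v0[of m] mult_left_mono[of 1 "P m" "v m"]
      by (auto simp: divide_le_eq)
    then have "expectation (W m) < \<delta>" using m n[of m] by (simp add: EW)
    then show "\<exists>n. expectation (W n) < \<delta>" by blast
  qed
  then show ?thesis
  proof eventually_elim
    case (elim w)
    show ?case
    proof (rule tendsto_sandwich[where f = "\<lambda>_. 0" and h = "\<lambda>i. K * W i w"])
      show "\<forall>\<^sub>F i in sequentially. V i w \<le> K * W i w"
      proof (rule always_eventually, intro allI)
        fix i
        have "V i w = P i * (V i w / P i)" using P1[of i] by simp
        also have "\<dots> \<le> K * (V i w / P i)"
          using PK[of i] P1[of i] nonneg[of i w] by (intro mult_right_mono) auto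
        also have "\<dots> \<le> K * W i w"
          using T0[of i] by (intro mult_left_mono) (auto simp: W_def K_def)
        finally show "V i w \<le> K * W i w" .
      qed
      show "(\<lambda>i. K * W i w) \<longlonglongrightarrow> 0" using tendsto_mult_left[OF elim, of K] by simp
    qed (auto simp: nonneg)
  qed
qed

subsection \<open>Algebraic and combinatorial connectivity\<close>

text \<open>The indicator vectors of \<open>T\<close> and of its complement both lie in the kernel
  of \<open>A\<close>, so the matrix \<open>C = X * 1 - A\<close> multiplies each of them by
  \<open>X\<close>. After a change of basis that includes these two vectors, two columns of
  \<open>C\<close> are divisible by \<open>X\<close>.\<close>

lemma sq_dvd_char_poly_of_split_kernel:
  fixes A :: "'a :: comm_ring_1 mat"
  assumes A: "A \<in> carrier_mat n n"
    and T: "T \<subseteq> {..<n}" and s: "s \<in> T" and t: "t < n" "t \<notin> T"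
    and kerT: "\<And>r. r < n \<Longrightarrow> (\<Sum>c\<in>T. A $$ (r, c)) = 0"
    and kerT': "\<And>r. r < n \<Longrightarrow> (\<Sum>c\<in>{..<n} - T. A $$ (r, c)) = 0"
  shows "[:0, 1:]\<^sup>2 dvd char_poly A"
proof -
  define X :: "'a poly" where "X = [:0, 1:]"
  define C where "C = char_poly_matrix A"
  have C: "C \<in> carrier_mat n n" using A by (simp add: C_def)
  have sn: "s < n" "s \<noteq> t" using s t T by auto
  have Centry: "C $$ (r, c) = (if r = c then X else 0) - [:A $$ (r, c):]" if "r < n" "c < n" for r c
    using that A by (auto simp: C_def char_poly_matrix_def X_def)
  have const_sum: "(\<Sum>c\<in>S. [:f c:]) = [:\<Sum>c\<in>S. f c:]" for S and f :: "nat \<Rightarrow> 'a"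
    by (induction S rule: infinite_finite_induct) auto
  have CT: "(\<Sum>c\<in>T. C $$ (r, c)) = (if r \<in> T then X else 0)" if "r < n" for r
  proof -
    have "(\<Sum>c\<in>T. C $$ (r, c)) = (\<Sum>c\<in>T. (if r = c then X else 0) - [:A $$ (r, c):])"
      using T that by (intro sum.cong) (auto simp: Centry)
    also have "\<dots> = (if r \<in> T then X else 0)"
      using kerT[OF that] finite_subset[OF T] by (simp add: sum_subtractf const_sum)
    finally show ?thesis .
  qed
  have CT': "(\<Sum>c\<in>{..<n} - T. C $$ (r, c)) = (if r \<notin> T then X else 0)" if "r < n" for r
  proof -
    have "(\<Sum>c\<in>{..<n} - T. C $$ (r, c)) = (\<Sum>c\<in>{..<n} - T. (if r = c then X else 0) - [:A $$ (r, c):])"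
      using T that by (intro sum.cong) (auto simp: Centry)
    also have "\<dots> = (if r \<notin> T then X else 0)"
      using kerT'[OF that] that by (simp add: sum_subtractf const_sum)
    finally show ?thesis .
  qed
  \<comment> \<open>\<open>U\<close> is the identity with columns \<open>s\<close> and
    \<open>t\<close> replaced by the two indicator vectors, and \<open>W\<close> is its inverse.
    \<open>C'\<close> is \<open>C * U\<close> with a factor \<open>X\<close> taken out of these two
    columns; \<open>D\<close> carries the factors.\<close>
  define D :: "'a poly mat" where "D = mat n n (\<lambda>(r, c). if r = c then if c = s \<or> c = t then X else 1 else 0)"
  define W :: "'a poly mat" where "W = mat n n (\<lambda>(r, c).
     if c = s then (if r = s then 1 else if r \<in> T then -1 else 0)
     else if c = t then (if r = t then 1 else if r \<notin> T then -1 else 0)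
     else if r = c then 1 else 0)"
  define U :: "'a poly mat" where "U = mat n n (\<lambda>(r, c).
     if c = s then (if r \<in> T then 1 else 0)
     else if c = t then (if r \<notin> T then 1 else 0)
     else if r = c then 1 else 0)"
  define C' where "C' = mat n n (\<lambda>(r, c).
     if c = s then (if r \<in> T then 1 else 0)
     else if c = t then (if r \<notin> T then 1 else 0)
     else C $$ (r, c))"
  have carr: "D \<in> carrier_mat n n" "W \<in> carrier_mat n n" "U \<in> carrier_mat n n" "C' \<in> carrier_mat n n"
    by (auto simp: D_def W_def U_def C'_def)
  have entry: "(P * Q) $$ (r, c) = (\<Sum>k<n. P $$ (r, k) * Q $$ (k, c))"
    if "P \<in> carrier_mat n n" "Q \<in> carrier_mat n n" "r < n" "c < n" for P Q :: "'a poly mat" and r c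
    using that by (auto simp: scalar_prod_def atLeast0LessThan intro!: sum.cong)
  have UW: "U * W = 1\<^sub>m n"
  proof (rule eq_matI)
    fix r c assume "r < dim_row (1\<^sub>m n :: 'a poly mat)" "c < dim_col (1\<^sub>m n :: 'a poly mat)"
    then have rc: "r < n" "c < n" by auto
    have "(U * W) $$ (r, c) = (\<Sum>k<n. U $$ (r, k) * W $$ (k, c))"
      using carr rc by (intro entry)
    also have "\<dots> = (\<Sum>k<n. (if k = r then W $$ (k, c) else 0)
        + (if k = s then (if r \<in> T \<and> r \<noteq> s then 1 else 0) * W $$ (k, c) else 0)
        + (if k = t then (if r \<notin> T \<and> r \<noteq> t then 1 else 0) * W $$ (k, c) else 0))"
      using rc s t sn by (intro sum.cong) (auto simp: U_def)
    also have "\<dots> = W $$ (r, c) + (if r \<in> T \<and> r \<noteq> s then 1 else 0) * W $$ (s, c)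
        + (if r \<notin> T \<and> r \<noteq> t then 1 else 0) * W $$ (t, c)"
      using rc sn t by (simp add: sum.distrib)
    also have "\<dots> = 1\<^sub>m n $$ (r, c)"
      using rc s t sn by (auto simp: W_def)
    finally show "(U * W) $$ (r, c) = 1\<^sub>m n $$ (r, c)" .
  qed (use carr in auto)
  have CU: "C * U = C' * D"
  proof (rule eq_matI)
    fix r c assume "r < dim_row (C' * D)" "c < dim_col (C' * D)"
    then have rc: "r < n" "c < n" using carr by auto
    have "(C * U) $$ (r, c) = (\<Sum>k<n. C $$ (r, k) * U $$ (k, c))"
      using carr rc C by (intro entry)
    also have "\<dots> = (if c = s then \<Sum>k\<in>T. C $$ (r, k) else if c = t then \<Sum>k\<in>{..<n} - T. C $$ (r, k)
        else C $$ (r, c))"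
    proof -
      have "(\<Sum>k<n. C $$ (r, k) * U $$ (k, s)) = (\<Sum>k\<in>T. C $$ (r, k))"
        using T sn by (intro sum.mono_neutral_cong_right) (auto simp: U_def)
      moreover have "(\<Sum>k<n. C $$ (r, k) * U $$ (k, t)) = (\<Sum>k\<in>{..<n} - T. C $$ (r, k))"
        using T sn t by (intro sum.mono_neutral_cong_right) (auto simp: U_def)
      moreover have "(\<Sum>k<n. C $$ (r, k) * U $$ (k, c)) = (\<Sum>k\<in>{c}. C $$ (r, k))" if "c \<noteq> s" "c \<noteq> t"
        using rc that by (intro sum.mono_neutral_cong_right) (auto simp: U_def)
      ultimately show ?thesis by auto
    qed
    also have "\<dots> = C' $$ (r, c) * D $$ (c, c)"
      using rc sn t by (auto simp: CT CT' C'_def D_def)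
    also have "\<dots> = (\<Sum>k\<in>{c}. C' $$ (r, k) * D $$ (k, c))" by simp
    also have "\<dots> = (\<Sum>k<n. C' $$ (r, k) * D $$ (k, c))"
      using rc by (intro sum.mono_neutral_left) (auto simp: D_def)
    also have "\<dots> = (C' * D) $$ (r, c)"
      using carr rc by (intro entry[symmetric])
    finally show "(C * U) $$ (r, c) = (C' * D) $$ (r, c)" .
  qed (use carr C in auto)
  have detD: "det D = X\<^sup>2"
  proof -
    have "det D = prod_list (diag_mat D)"
      using carr by (intro det_upper_triangular) (auto simp: D_def)
    also have "\<dots> = (\<Prod>i<n. if i = s \<or> i = t then X else 1)"
      using carr by (auto simp: prod_list_diag_prod D_def atLeast0LessThan intro!: prod.cong)
    also have "\<dots> = (\<Prod>i\<in>{s, t}. X)"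
      using sn t by (intro prod.mono_neutral_cong_right) auto
    also have "\<dots> = X\<^sup>2" using sn by (simp add: power2_eq_square)
    finally show ?thesis .
  qed
  have "C = C * U * W" using C carr UW by (simp add: assoc_mult_mat[of _ n n _ n _ n])
  also have "\<dots> = C' * D * W" by (simp add: CU)
  finally have "det C = det C' * X\<^sup>2 * det W"
    using carr det_mult[of "C' * D" n W] det_mult[of C' n D] by (simp add: detD)
  then show ?thesis unfolding char_poly_def C_def[symmetric] X_def by simp
qed

text \<open>Of two zeros in the sorted list of eigenvalues at least one stands behind the head, and
  by sortedness the entry at position 1 is at most that zero.\<close>

lemma lambda2_le_zero:
  assumes A: "A \<in> carrier_mat n n" and "[:0, 1:]\<^sup>2 dvd char_poly A"
  shows "lambda2 A \<le> 0"
proof -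
  have nz: "char_poly A \<noteq> 0"
    using degree_monic_char_poly[OF A] by (metis coeff_0 zero_neq_one)
  have "2 \<le> order 0 (char_poly A)"
    using order_max[of 0 2 "char_poly A"] assms(2) nz by simp
  then have cnt0: "2 \<le> count (proots (char_poly A)) 0" using nz by simp
  let ?l = "sorted_eigenvalues A"
  have l: "mset ?l = proots (char_poly A)" "sorted ?l" by (auto simp: sorted_eigenvalues_def)
  have cnt: "2 \<le> count (mset ?l) 0" unfolding l by (rule cnt0)
  show ?thesis
  proof (rule ccontr)
    assume "\<not> lambda2 A \<le> 0"
    then have pos: "0 < ?l ! 1" by (simp add: lambda2_def)
    obtain x xs where xs: "?l = x # xs" using cnt by (cases ?l) auto
    have "count (mset (x # xs)) 0 \<le> Suc (count (mset xs) 0)" by simp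
    then have "0 < count (mset xs) 0" using cnt[unfolded xs] by linarith
    then have "0 \<in># mset xs" unfolding count_greater_zero_iff .
    then obtain k where k: "k < length xs" "xs ! k = 0" by (auto simp: in_set_conv_nth)
    have "xs ! 0 \<le> xs ! k" using l(2) xs k by (intro sorted_nth_mono) auto
    then show False using pos xs k by simp
  qed
qed

text \<open>Call \<open>n\<close> and \<open>l\<close> related if the weighted form \<open>Q\<close>
  dominates \<open>(x n - x l)\<^sup>2\<close> up to a constant independent of \<open>x\<close>.
  Edges of positive weight are related and the relation is transitive, so the class of node 0 has no
  outgoing edge and must contain all nodes.\<close>

lemma no_cut_poincare:
  fixes p :: "nat \<Rightarrow> nat \<Rightarrow> real"
  assumes nonneg: "\<And>n l. 0 \<le> p n l"
    and no_cut: "\<And>T. T \<subseteq> {..<N} \<Longrightarrow> T \<noteq> {} \<Longrightarrow> T \<noteq> {..<N} \<Longrightarrow> \<exists>n\<in>T. \<exists>l\<in>{..<N} - T. p n l \<noteq> 0"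
    and N: "0 < N"
  shows "\<exists>c>0. \<forall>x :: nat \<Rightarrow> real. c * (\<Sum>n<N. \<Sum>l<N. (x n - x l)\<^sup>2) \<le> (\<Sum>n<N. \<Sum>l<N. p n l * (x n - x l)\<^sup>2)"
proof -
  define Q where "Q x = (\<Sum>n<N. \<Sum>l<N. p n l * (x n - x l)\<^sup>2)" for x :: "nat \<Rightarrow> real"
  define R where "R n l \<longleftrightarrow> (\<exists>C. \<forall>x. (x n - x l)\<^sup>2 \<le> C * Q x)" for n l :: nat
  have sq2: "(a - c)\<^sup>2 \<le> 2 * (a - b)\<^sup>2 + 2 * (b - c)\<^sup>2" for a b c :: real
    using zero_le_power2[of "(a - b) - (b - c)"] by (simp add: power2_eq_square algebra_simps)
  have Q0: "0 \<le> Q x" for x unfolding Q_def using nonneg by (intro sum_nonneg mult_nonneg_nonneg) auto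
  have Rrefl: "R n n" for n unfolding R_def by (intro exI[of _ 0]) auto
  have Rtrans: "R n m" if "R n l" "R l m" for n l m
  proof -
    obtain C D where "\<forall>x. (x n - x l)\<^sup>2 \<le> C * Q x" "\<forall>x. (x l - x m)\<^sup>2 \<le> D * Q x"
      using \<open>R n l\<close> \<open>R l m\<close> unfolding R_def by blast
    then have "(x n - x m)\<^sup>2 \<le> (2 * C + 2 * D) * Q x" for x
      using sq2[of "x n" "x m" "x l"] by (smt (verit) distrib_right mult.assoc)
    then show ?thesis unfolding R_def by blast
  qed
  have Redge: "R n l" if "n < N" "l < N" "p n l \<noteq> 0" for n l
  proof -
    have "(x n - x l)\<^sup>2 \<le> inverse (p n l) * Q x" for x
    proof -
      have "p n l * (x n - x l)\<^sup>2 \<le> (\<Sum>l<N. p n l * (x n - x l)\<^sup>2)"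
        using that nonneg by (intro member_le_sum) auto
      also have "\<dots> \<le> Q x"
        unfolding Q_def using that nonneg by (intro member_le_sum[of n] sum_nonneg) auto
      finally show ?thesis using that nonneg[of n l] by (simp add: field_simps)
    qed
    then show ?thesis unfolding R_def by blast
  qed
  define T where "T = {l. l < N \<and> R 0 l}"
  have "T = {..<N}"
  proof (rule ccontr)
    assume "T \<noteq> {..<N}"
    moreover have "0 \<in> T" using N Rrefl by (simp add: T_def)
    ultimately obtain n l where "n \<in> T" "l < N" "l \<notin> T" "p n l \<noteq> 0"
      using no_cut[of T] by (auto simp: T_def)
    then show False using Rtrans[of 0 n l] Redge[of n l] by (auto simp: T_def)
  qed
  then have "R n l" if "n < N" "l < N" for n l
  proof -
    have "R 0 n" "R 0 l" using that \<open>T = {..<N}\<close> by (auto simp: T_def)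
    moreover from this(1) have "R n 0" unfolding R_def by (simp add: power2_commute)
    ultimately show ?thesis using Rtrans by blast
  qed
  then have "\<forall>n l. \<exists>C. n < N \<longrightarrow> l < N \<longrightarrow> (\<forall>x. (x n - x l)\<^sup>2 \<le> C * Q x)"
    unfolding R_def by blast
  then obtain C where C: "\<And>n l x. n < N \<Longrightarrow> l < N \<Longrightarrow> (x n - x l)\<^sup>2 \<le> C n l * Q x"
    by metis
  \<comment> \<open>The added 1 keeps \<open>K\<close> positive, so that it can be inverted, even if
    all the constants vanish.\<close>
  define K where "K = (\<Sum>n<N. \<Sum>l<N. \<bar>C n l\<bar>) + 1"
  have K: "0 < K" unfolding K_def by (intro add_nonneg_pos sum_nonneg) auto
  have "inverse K * (\<Sum>n<N. \<Sum>l<N. (x n - x l)\<^sup>2) \<le> Q x" for x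
  proof -
    have "(\<Sum>n<N. \<Sum>l<N. (x n - x l)\<^sup>2) \<le> (\<Sum>n<N. \<Sum>l<N. \<bar>C n l\<bar> * Q x)"
    proof (intro sum_mono)
      fix n l assume "n \<in> {..<N}" "l \<in> {..<N}"
      then have "(x n - x l)\<^sup>2 \<le> C n l * Q x" by (intro C) auto
      also have "\<dots> \<le> \<bar>C n l\<bar> * Q x" using Q0 by (intro mult_right_mono) auto
      finally show "(x n - x l)\<^sup>2 \<le> \<bar>C n l\<bar> * Q x" .
    qed
    also have "\<dots> = (\<Sum>n<N. \<Sum>l<N. \<bar>C n l\<bar>) * Q x" by (simp add: sum_distrib_right)
    also have "\<dots> \<le> K * Q x" using Q0 by (intro mult_right_mono) (auto simp: K_def)
    finally show ?thesis using K by (simp add: field_simps)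
  qed
  then show ?thesis using K unfolding Q_def by (intro exI[of _ "inverse K"]) auto
qed

subsection \<open>Independence and dithered quantization\<close>

text \<open>A finite intersection splits into a left part in \<open>Y\<close> and a right part in
  \<open>Z\<close>. Independence of \<open>Y\<close> and \<open>Z\<close> factors the two parts, and
  independence inside each family factors the rest.\<close>

lemma (in prob_space) indep_sets_Plus:
  assumes E: "indep_sets E I" and G: "indep_sets G K"
    and ind: "indep_set (sets Y) (sets Z)"
    and sp: "space Y = space M" "space Z = space M"
    and EY: "\<And>i. i \<in> I \<Longrightarrow> E i \<subseteq> sets Y" and GZ: "\<And>k. k \<in> K \<Longrightarrow> G k \<subseteq> sets Z"
  shows "indep_sets (case_sum E G) (I <+> K)"
proof (rule indep_setsI)
  fix k assume "k \<in> I <+> K"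
  then show "case_sum E G k \<subseteq> events"
    using E[unfolded indep_sets_def, THEN conjunct1] G[unfolded indep_sets_def, THEN conjunct1]
    by (elim PlusE) simp_all
next
  fix A J assume J: "J \<noteq> {}" "J \<subseteq> I <+> K" "finite J" "\<forall>j\<in>J. A j \<in> case_sum E G j"
  define J1 where "J1 = Inl -` J"
  define J2 where "J2 = Inr -` J"
  have fin: "finite J1" "finite J2"
    using J(3) by (auto simp: J1_def J2_def intro!: finite_vimageI)
  have Jeq: "J = Inl ` J1 \<union> Inr ` J2"
  proof (intro equalityI subsetI)
    fix x assume "x \<in> J"
    then show "x \<in> Inl ` J1 \<union> Inr ` J2" by (cases x) (auto simp: J1_def J2_def)
  qed (auto simp: J1_def J2_def)
  have J1: "J1 \<subseteq> I" "\<forall>j\<in>J1. A (Inl j) \<in> E j" and J2: "J2 \<subseteq> K" "\<forall>j\<in>J2. A (Inr j) \<in> G j"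
    using J by (auto simp: J1_def J2_def)
  \<comment> \<open>Intersecting with \<open>space M\<close> gives the empty intersection
    probability 1, the value of the empty product.\<close>
  define a where "a = space M \<inter> (\<Inter>j\<in>J1. A (Inl j))"
  define b where "b = space M \<inter> (\<Inter>j\<in>J2. A (Inr j))"
  have AY: "A (Inl j) \<in> sets Y" if "j \<in> J1" for j using that J1 EY by blast
  have AZ: "A (Inr j) \<in> sets Z" if "j \<in> J2" for j using that J2 GZ by blast
  have aY: "a \<in> sets Y"
  proof (cases "J1 = {}")
    case True
    then show ?thesis using sets.top[of Y] by (simp add: a_def sp)
  next
    case False
    then have "space Y \<inter> (\<Inter>j\<in>J1. A (Inl j)) \<in> sets Y"
      using fin AY by (intro sets.Int sets.top sets.finite_INT) auto
    then show ?thesis by (simp add: a_def sp)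
  qed
  have bZ: "b \<in> sets Z"
  proof (cases "J2 = {}")
    case True
    then show ?thesis using sets.top[of Z] by (simp add: b_def sp)
  next
    case False
    then have "space Z \<inter> (\<Inter>j\<in>J2. A (Inr j)) \<in> sets Z"
      using fin AZ by (intro sets.Int sets.top sets.finite_INT) auto
    then show ?thesis by (simp add: b_def sp)
  qed
  have Aspace: "A j \<subseteq> space M" if "j \<in> J" for j
    using that sets.sets_into_space[OF AY] sets.sets_into_space[OF AZ] unfolding Jeq sp by auto
  have pa: "prob a = (\<Prod>j\<in>J1. prob (A (Inl j)))"
  proof (cases "J1 = {}")
    case True
    then show ?thesis by (simp add: a_def prob_space)
  next
    case False
    then have "a = (\<Inter>j\<in>J1. A (Inl j))"
      using Aspace unfolding a_def Jeq by auto
    then show ?thesis using indep_setsD[OF E J1(1) False fin(1), of "\<lambda>j. A (Inl j)"] J1(2) by simp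
  qed
  have pb: "prob b = (\<Prod>j\<in>J2. prob (A (Inr j)))"
  proof (cases "J2 = {}")
    case True
    then show ?thesis by (simp add: b_def prob_space)
  next
    case False
    then have "b = (\<Inter>j\<in>J2. A (Inr j))"
      using Aspace unfolding b_def Jeq by auto
    then show ?thesis using indep_setsD[OF G J2(1) False fin(2), of "\<lambda>j. A (Inr j)"] J2(2) by simp
  qed
  have "(\<Inter>j\<in>J. A j) = space M \<inter> (\<Inter>j\<in>J. A j)" using Aspace J(1) by blast
  also have "\<dots> = a \<inter> b" unfolding a_def b_def Jeq by auto
  finally have "prob (\<Inter>j\<in>J. A j) = prob a * prob b"
    using indep_setD[OF ind aY bZ] by simp
  also have "\<dots> = (\<Prod>j\<in>Inl ` J1. prob (A j)) * (\<Prod>j\<in>Inr ` J2. prob (A j))"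
    unfolding pa pb by (simp add: prod.reindex)
  also have "\<dots> = (\<Prod>j\<in>J. prob (A j))"
    unfolding Jeq using fin by (intro prod.union_disjoint[symmetric]) auto
  finally show "prob (\<Inter>j\<in>J. A j) = (\<Prod>j\<in>J. prob (A j))" .
qed

lemma (in prob_space) indep_set_sigma_sets_Union:
  assumes E: "indep_sets E I" and st: "\<And>i. i \<in> I \<Longrightarrow> Int_stable (E i)"
    and J: "J \<subseteq> I" "J' \<subseteq> I" "J \<inter> J' = {}"
  shows "indep_set (sigma_sets (space M) (\<Union>k\<in>J. E k)) (sigma_sets (space M) (\<Union>k\<in>J'. E k))"
proof -
  have U: "(\<Union>b\<in>UNIV. case_bool J J' b) = J \<union> J'" by (auto simp: UNIV_bool)
  have "indep_sets (\<lambda>b. sigma_sets (space M) (\<Union>k\<in>case_bool J J' b. E k)) UNIV"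
  proof (rule indep_sets_collect_sigma)
    show "indep_sets E (\<Union>b\<in>UNIV. case_bool J J' b)"
      unfolding U using J by (intro indep_sets_mono_index[OF _ E]) auto
    show "Int_stable (E i)" if "i \<in> case_bool J J' b" for i b
      using that J by (intro st) (auto split: bool.splits)
    show "disjoint_family_on (case_bool J J') UNIV"
      using J(3) by (auto simp: disjoint_family_on_def split: bool.splits)
  qed
  then show ?thesis unfolding indep_set_def
    by (rule indep_sets_mono_sets) (auto split: bool.splits)
qed

lemma (in prob_space) indep_var_of_subalgebras:
  assumes ind: "indep_set (sets Y) (sets Z)" and sub: "subalgebra M Y" "subalgebra M Z"
    and X: "X \<in> measurable Y S" "X' \<in> measurable Z T"
  shows "indep_var S X T X'"
  unfolding indep_var_eq
proof (intro conjI)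
  show "random_variable S X" "random_variable T X'"
    using measurable_from_subalg[OF sub(1)] measurable_from_subalg[OF sub(2)] X by auto
  have sp: "space Y = space M" "space Z = space M" using sub by (auto simp: subalgebra_def)
  have 1: "sigma_sets (space M) {X -` A \<inter> space M |A. A \<in> sets S} \<subseteq> sets Y"
    using X(1) sets.sigma_sets_subset[of "{X -` A \<inter> space M |A. A \<in> sets S}" Y] sp
    by (auto simp: measurable_def)
  have 2: "sigma_sets (space M) {X' -` A \<inter> space M |A. A \<in> sets T} \<subseteq> sets Z"
    using X(2) sets.sigma_sets_subset[of "{X' -` A \<inter> space M |A. A \<in> sets T}" Z] sp
    by (auto simp: measurable_def)
  show "indep_set (sigma_sets (space M) {X -` A \<inter> space M |A. A \<in> sets S})
     (sigma_sets (space M) {X' -` A \<inter> space M |A. A \<in> sets T})"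
    using ind 1 2 unfolding indep_set_def
    by (elim indep_sets_mono_sets) (auto split: bool.splits)
qed

text \<open>Plays the role of \<open>h (X, U)\<close> having conditional mean 0 given
  \<open>G\<close>: by Fubini \<open>U\<close> can be integrated out with \<open>(Y, X)\<close>
  frozen. The weight \<open>Y\<close> later collects every other factor known at that moment, test
  events included.\<close>

lemma (in prob_space) expectation_indep_kernel_zero:
  fixes Y X U :: "'a \<Rightarrow> real" and h :: "real \<Rightarrow> real \<Rightarrow> real"
  assumes ind: "indep_set (sets G) (sets H)" and sub: "subalgebra M G" "subalgebra M H"
    and YX [measurable]: "Y \<in> borel_measurable G" "X \<in> borel_measurable G"
    and U: "U \<in> borel_measurable H"
    and h [measurable]: "(\<lambda>(x, u). h x u) \<in> borel_measurable (borel \<Otimes>\<^sub>M borel)"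
    and int: "integrable M (\<lambda>w. Y w * h (X w) (U w))"
    and zero: "\<And>x. (\<integral>u. h x u \<partial>distr M borel U) = 0"
  shows "expectation (\<lambda>w. Y w * h (X w) (U w)) = 0"
proof -
  let ?B = "borel \<Otimes>\<^sub>M borel :: (real \<times> real) measure"
  \<comment> \<open>\<open>indep_var\<close> wants both variables of the same type, hence the dummy component 0.\<close>
  have ind: "indep_var ?B (\<lambda>w. (Y w, X w)) ?B (\<lambda>w. (0, U w))"
    using U by (intro indep_var_of_subalgebras[OF ind sub]) measurable
  define Q where "Q = distr M ?B (\<lambda>w. (Y w, X w))"
  define R where "R = distr M ?B (\<lambda>w. (0, U w))"
  note rv = indep_var_rv1[OF ind] indep_var_rv2[OF ind]
  have UM [measurable]: "U \<in> borel_measurable M" using U sub(2) by (rule measurable_from_subalg[rotated])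
  interpret Q: prob_space Q unfolding Q_def by (rule prob_space_distr[OF rv(1)])
  interpret R: prob_space R unfolding R_def by (rule prob_space_distr[OF rv(2)])
  interpret QR: pair_sigma_finite Q R ..
  let ?f = "\<lambda>(z, u). fst z * h (snd z) (snd u) :: real"
  have f: "?f \<in> borel_measurable (?B \<Otimes>\<^sub>M ?B)"
  proof -
    have "(\<lambda>z. (\<lambda>(x, u). h x u) (snd (fst z), snd (snd z))) \<in> borel_measurable (?B \<Otimes>\<^sub>M ?B)"
      by measurable
    then have "(\<lambda>z. fst (fst z) * h (snd (fst z)) (snd (snd z))) \<in> borel_measurable (?B \<Otimes>\<^sub>M ?B)"
      by (intro borel_measurable_times) auto
    then show ?thesis by (simp add: split_beta')
  qed
  have pr: "(\<lambda>w. ((Y w, X w), (0, U w))) \<in> measurable M (?B \<Otimes>\<^sub>M ?B)"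
    using rv by (rule measurable_Pair)
  have dist: "Q \<Otimes>\<^sub>M R = distr M (?B \<Otimes>\<^sub>M ?B) (\<lambda>w. ((Y w, X w), (0, U w)))"
    using ind unfolding indep_var_distribution_eq Q_def R_def by simp
  have intf: "integrable (Q \<Otimes>\<^sub>M R) ?f"
    unfolding dist using integrable_distr_eq[OF pr f] int by simp
  have zero': "(\<integral>u. h x (snd u) \<partial>R) = 0" for x
  proof -
    have hx: "h x \<in> borel_measurable borel"
      using measurable_compose[OF measurable_Pair1' h, of x] by simp
    have "(\<integral>u. h x (snd u) \<partial>R) = expectation (\<lambda>w. h x (U w))"
      unfolding R_def using measurable_compose[OF measurable_snd hx] rv(2)
      by (subst integral_distr) auto
    then show ?thesis using zero[of x] integral_distr[OF UM hx] by simp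
  qed
  have "expectation (\<lambda>w. Y w * h (X w) (U w)) = (\<integral>z. ?f z \<partial>(Q \<Otimes>\<^sub>M R))"
    unfolding dist using integral_distr[OF pr f] by simp
  also have "\<dots> = (\<integral>z. (\<integral>u. fst z * h (snd z) (snd u) \<partial>R) \<partial>Q)"
    using QR.integral_fst'[OF intf] by simp
  also have "\<dots> = 0" using zero' by simp
  finally show ?thesis .
qed

section \<open>Size and mean of the dithered quantization error\<close>

lemma quant_borel [measurable]: "quant \<Delta> \<in> borel_measurable borel"
  unfolding quant_def by measurable

lemma quant_error:
  assumes "0 < \<Delta>"
  shows "\<bar>quant \<Delta> y - y\<bar> \<le> \<Delta> / 2"
proof -
  have "quant \<Delta> y - y = \<Delta> * (of_int \<lfloor>y / \<Delta> + 1/2\<rfloor> - y / \<Delta>)"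
    using assms by (simp add: quant_def algebra_simps)
  moreover have "\<bar>of_int \<lfloor>y / \<Delta> + 1/2\<rfloor> - y / \<Delta>\<bar> \<le> 1 / 2" by linarith
  ultimately show ?thesis using assms
    by (simp add: abs_mult mult_left_mono[of _ "1/2", simplified])
qed

text \<open>Schuchman's condition: subtracting the signal from the dithered quantizer output
  leaves, over one period, the two values \<open>-f\<close> and \<open>\<Delta> - f\<close> with weights \<open>1 - f/\<Delta>\<close> and \<open>f/\<Delta>\<close>.\<close>
lemma quant_dither_unbiased:
  assumes "0 < \<Delta>"
  shows "(\<integral>u. quant \<Delta> (x + u) - x \<partial>uniform_measure lborel {-\<Delta>/2..<\<Delta>/2}) = 0"
proof -
  define D where "D = uniform_measure lborel {-\<Delta>/2..<\<Delta>/2}"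
  define k where "k = \<lfloor>x / \<Delta>\<rfloor>"
  define f where "f = x - k * \<Delta>"
  have "of_int k \<le> x / \<Delta>" "x / \<Delta> < of_int k + 1" unfolding k_def by linarith+
  then have f: "0 \<le> f" "f < \<Delta>" using assms by (auto simp: f_def field_simps)
  interpret D: prob_space D
    unfolding D_def using assms by (intro prob_space_uniform_measure) auto
  have AE_D: "AE u in D. u \<in> {-\<Delta>/2..<\<Delta>/2}"
    unfolding D_def by (rule AE_uniform_measureI) auto
  have setsD [measurable_cong]: "sets D = sets borel" by (simp add: D_def)
  \<comment> \<open>With \<open>x = k * \<Delta> + f\<close>, the sum \<open>x + u\<close> crosses
    the decision level \<open>(k + 1/2) * \<Delta>\<close> exactly at
    \<open>u = \<Delta>/2 - f\<close>, and no other level is crossed inside the dither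
    interval.\<close>
  have "(\<integral>u. quant \<Delta> (x + u) - x \<partial>D) = (\<integral>u. -f + \<Delta> * indicator {\<Delta>/2 - f..<\<Delta>/2} u \<partial>D)"
  proof (rule integral_cong_AE)
    show "AE u in D. quant \<Delta> (x + u) - x = -f + \<Delta> * indicator {\<Delta>/2 - f..<\<Delta>/2} u"
      using AE_D
    proof eventually_elim
      case (elim u)
      show ?case
      proof (cases "\<Delta>/2 - f \<le> u")
        case True
        have "\<lfloor>(x + u) / \<Delta> + 1/2\<rfloor> = k + 1"
          using True elim assms f by (intro floor_unique) (auto simp: f_def field_simps)
        then show ?thesis using True elim by (simp add: quant_def f_def algebra_simps)
      next
        case False
        have "\<lfloor>(x + u) / \<Delta> + 1/2\<rfloor> = k"
          using False elim assms f by (intro floor_unique) (auto simp: f_def field_simps)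
        then show ?thesis using False elim by (simp add: quant_def f_def algebra_simps)
      qed
    qed
  qed measurable
  also have "\<dots> = -f + \<Delta> * measure D {\<Delta>/2 - f..<\<Delta>/2}"
    by (subst Bochner_Integration.integral_add) (auto simp: D.prob_space D.emeasure_eq_measure setsD)
  also have "measure D {\<Delta>/2 - f..<\<Delta>/2} = f / \<Delta>"
  proof -
    have "{-\<Delta>/2..<\<Delta>/2} \<inter> {\<Delta>/2 - f..<\<Delta>/2} = {\<Delta>/2 - f..<\<Delta>/2}" using f by auto
    then show ?thesis unfolding D_def using assms f
      by (subst measure_uniform_measure) auto
  qed
  finally show ?thesis using assms by (simp add: D_def)
qed

section \<open>Almost surely bounded random variables\<close>

text \<open>The bound is only almost sure because the dither is confined to its interval only
  through its law. Closure under sums and products settles the integrability of all terms of the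
  recursion.\<close>

definition (in prob_space) ess_bounded :: "('a \<Rightarrow> real) \<Rightarrow> bool" where
  "ess_bounded f \<longleftrightarrow> f \<in> borel_measurable M \<and> (\<exists>K. AE w in M. \<bar>f w\<bar> \<le> K)"

context prob_space
begin

lemma ess_bounded_integrable:
  assumes "ess_bounded f" shows "integrable M f"
proof -
  obtain K where "AE w in M. norm (f w) \<le> K"
    using assms unfolding ess_bounded_def real_norm_def by blast
  then show ?thesis using assms unfolding ess_bounded_def by (intro integrable_const_bound) auto
qed

lemma ess_boundedI: "f \<in> borel_measurable M \<Longrightarrow> (\<And>w. \<bar>f w\<bar> \<le> K) \<Longrightarrow> ess_bounded f"
  unfolding ess_bounded_def by auto

lemma ess_bounded_const: "ess_bounded (\<lambda>_. c)"
  by (rule ess_boundedI) auto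

lemma ess_bounded_indicator: "B \<in> events \<Longrightarrow> ess_bounded (indicator B)"
  by (rule ess_boundedI[of _ 1]) (auto simp: indicator_def)

lemma ess_bounded_add:
  assumes "ess_bounded f" "ess_bounded g" shows "ess_bounded (\<lambda>w. f w + g w)"
proof -
  obtain K L where "AE w in M. \<bar>f w\<bar> \<le> K" "AE w in M. \<bar>g w\<bar> \<le> L"
    using assms unfolding ess_bounded_def by blast
  then have "AE w in M. \<bar>f w + g w\<bar> \<le> K + L" by eventually_elim linarith
  then show ?thesis using assms unfolding ess_bounded_def by auto
qed

lemma ess_bounded_mult:
  assumes "ess_bounded f" "ess_bounded g" shows "ess_bounded (\<lambda>w. f w * g w)"
proof -
  obtain K L where "AE w in M. \<bar>f w\<bar> \<le> K" "AE w in M. \<bar>g w\<bar> \<le> L"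
    using assms unfolding ess_bounded_def by blast
  then have "AE w in M. \<bar>f w * g w\<bar> \<le> K * L"
    by eventually_elim (simp add: abs_mult mult_mono')
  then show ?thesis using assms unfolding ess_bounded_def by auto
qed

lemma ess_bounded_diff:
  assumes "ess_bounded f" "ess_bounded g" shows "ess_bounded (\<lambda>w. f w - g w)"
  using ess_bounded_add[OF assms(1) ess_bounded_mult[OF ess_bounded_const[of "-1"] assms(2)]] by simp

lemma ess_bounded_power2: "ess_bounded f \<Longrightarrow> ess_bounded (\<lambda>w. (f w)\<^sup>2)"
  using ess_bounded_mult[of f f] by (simp add: power2_eq_square)

lemma ess_bounded_sum:
  "(\<And>i. i \<in> S \<Longrightarrow> ess_bounded (f i)) \<Longrightarrow> ess_bounded (\<lambda>w. \<Sum>i\<in>S. f i w)"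
  by (induction S rule: infinite_finite_induct) (auto intro: ess_bounded_add ess_bounded_const)

lemmas ess_bounded_intros = ess_bounded_const ess_bounded_indicator ess_bounded_add
  ess_bounded_mult ess_bounded_diff ess_bounded_power2 ess_bounded_sum

end

subsection \<open>The consensus recursion\<close>

definition spread :: "nat \<Rightarrow> (nat \<Rightarrow> real) \<Rightarrow> real" where
  "spread N x = (\<Sum>n<N. \<Sum>l<N. (x n - x l)\<^sup>2)"

lemma spread_nonneg: "0 \<le> spread N x"
  unfolding spread_def by (intro sum_nonneg) auto

lemma dist_consensus_nonneg: "0 \<le> dist_consensus N x"
  unfolding dist_consensus_def by (intro cINF_greatest) (auto intro!: sum_nonneg)

text \<open>The competitor \<open>a = x 0\<close> yields just the terms of the spread with
  \<open>l = 0\<close>.\<close>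

lemma dist_consensus_le_spread:
  assumes "0 < N"
  shows "dist_consensus N x \<le> sqrt (spread N x)"
proof -
  have "dist_consensus N x \<le> sqrt (\<Sum>n<N. (x n - x 0)\<^sup>2)"
    unfolding dist_consensus_def
    by (intro cINF_lower bdd_belowI[of _ 0]) (auto intro!: sum_nonneg)
  also have "(\<Sum>n<N. (x n - x 0)\<^sup>2) \<le> spread N x"
    unfolding spread_def using assms by (intro sum_mono member_le_sum) auto
  finally show ?thesis by simp
qed

text \<open>A pathwise estimate: with \<open>x' = x - \<alpha> * g\<close> the square expands
  exactly. The term linear in \<open>e\<close> is kept as it stands, since its mean will vanish;
  only the term quadratic in \<open>\<alpha>\<close> is estimated.\<close>

lemma spread_step:
  fixes x x' :: "nat \<Rightarrow> real" and a e :: "nat \<Rightarrow> nat \<Rightarrow> real"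
  assumes a: "\<And>n l. 0 \<le> a n l" "\<And>n l. a n l \<le> 1" "\<And>n l. a n l = a l n"
    and e: "\<And>n l. n < N \<Longrightarrow> l < N \<Longrightarrow> \<bar>e n l\<bar> \<le> \<Delta>"
    and x': "\<And>n. n < N \<Longrightarrow> x' n = x n - \<alpha> * (\<Sum>l<N. a n l * (x n - x l - e n l))"
  shows "spread N x' \<le> (1 + 8 * (real N)\<^sup>2 * \<alpha>\<^sup>2) * spread N x
      - 2 * \<alpha> * real N * (\<Sum>n<N. \<Sum>l<N. a n l * (x n - x l)\<^sup>2)
      + 4 * \<alpha> * (\<Sum>n<N. \<Sum>l<N. (\<Sum>k<N. x n - x k) * a n l * e n l)
      + 8 * (real N)^4 * \<Delta>\<^sup>2 * \<alpha>\<^sup>2"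
proof -
  define g where "g n = (\<Sum>l<N. a n l * (x n - x l - e n l))" for n
  define z where "z n = (\<Sum>k<N. x n - x k)" for n
  have xg: "x' n = x n - \<alpha> * g n" if "n < N" for n
    using x'[OF that] by (simp add: g_def)
  have swap: "(\<Sum>n<N. \<Sum>l<N. f n l) = (\<Sum>n<N. \<Sum>l<N. f l n)" for f :: "nat \<Rightarrow> nat \<Rightarrow> real"
    by (rule sum.swap)
  have "spread N x' = (\<Sum>n<N. \<Sum>l<N. (x n - x l)\<^sup>2 - 2 * \<alpha> * ((x n - x l) * (g n - g l)) + \<alpha>\<^sup>2 * (g n - g l)\<^sup>2)"
    unfolding spread_def by (intro sum.cong refl) (simp add: xg power2_eq_square algebra_simps)
  then have expand: "spread N x' = spread N x - 2 * \<alpha> * (\<Sum>n<N. \<Sum>l<N. (x n - x l) * (g n - g l)) + \<alpha>\<^sup>2 * spread N g"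
    by (simp add: sum.distrib sum_subtractf sum_distrib_left spread_def)
  have drift: "(\<Sum>n<N. \<Sum>l<N. (x n - x l) * (g n - g l)) = real N * (\<Sum>n<N. \<Sum>l<N. a n l * (x n - x l)\<^sup>2)
      - 2 * (\<Sum>n<N. \<Sum>l<N. z n * a n l * e n l)"
  proof -
    have "(\<Sum>n<N. \<Sum>l<N. (x n - x l) * (g n - g l))
        = (\<Sum>n<N. \<Sum>l<N. (x n - x l) * g n) + (\<Sum>n<N. \<Sum>l<N. (x l - x n) * g l)"
      by (simp add: sum.distrib[symmetric] algebra_simps)
    also have "(\<Sum>n<N. \<Sum>l<N. (x l - x n) * g l) = (\<Sum>n<N. \<Sum>l<N. (x n - x l) * g n)"
      by (rule swap)
    also have "(\<Sum>n<N. \<Sum>l<N. (x n - x l) * g n) = (\<Sum>n<N. z n * g n)"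
      by (simp add: z_def sum_distrib_right)
    also have "\<dots> = (\<Sum>n<N. \<Sum>l<N. z n * a n l * (x n - x l)) - (\<Sum>n<N. \<Sum>l<N. z n * a n l * e n l)"
      by (simp add: g_def sum_distrib_left sum_subtractf[symmetric] algebra_simps)
    also have "(\<Sum>n<N. \<Sum>l<N. z n * a n l * (x n - x l)) = real N / 2 * (\<Sum>n<N. \<Sum>l<N. a n l * (x n - x l)\<^sup>2)"
    proof -
      \<comment> \<open>\<open>z n\<close> is \<open>N\<close> times the deviation of
        \<open>x n\<close> from the average. Exchanging \<open>n\<close> and \<open>l\<close> and
        using the symmetry of \<open>a\<close> therefore turns the sum into half of \<open>N\<close>
        times the quadratic form.\<close>
      have zd: "z n - z l = real N * (x n - x l)" for n l
        by (simp add: z_def sum_subtractf algebra_simps)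
      have "2 * (\<Sum>n<N. \<Sum>l<N. z n * a n l * (x n - x l))
          = (\<Sum>n<N. \<Sum>l<N. z n * a n l * (x n - x l)) + (\<Sum>n<N. \<Sum>l<N. z l * a l n * (x l - x n))"
        by (subst swap[of "\<lambda>n l. z l * a l n * (x l - x n)"]) simp
      also have "\<dots> = (\<Sum>n<N. \<Sum>l<N. a n l * (x n - x l) * (z n - z l))"
        by (simp add: sum.distrib[symmetric] a(3)[of _ _] algebra_simps)
      also have "\<dots> = real N * (\<Sum>n<N. \<Sum>l<N. a n l * (x n - x l)\<^sup>2)"
        by (simp add: zd sum_distrib_left power2_eq_square algebra_simps)
      finally show ?thesis by simp
    qed
    finally show ?thesis by simp
  qed
  have sq: "(u - v)\<^sup>2 \<le> 2 * u\<^sup>2 + 2 * v\<^sup>2" for u v :: real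
    using zero_le_power2[of "u + v"] by (simp add: power2_eq_square algebra_simps)
  have gn: "(g n)\<^sup>2 \<le> 2 * real N * (\<Sum>l<N. (x n - x l)\<^sup>2) + 2 * (real N)\<^sup>2 * \<Delta>\<^sup>2" if n: "n < N" for n
  proof -
    \<comment> \<open>Cauchy-Schwarz costs a factor \<open>N\<close>, separating signal from error a
      factor 2. The later passage from \<open>spread N g\<close> to the sum of squares costs
      \<open>4 * N\<close>, which explains \<open>8 * N\<^sup>2\<close> and, after summing the
      constant error over both indices, \<open>8 * N^4\<close>.\<close>
    have "(g n)\<^sup>2 \<le> (\<Sum>l<N. (a n l * (x n - x l - e n l))\<^sup>2) * real (card {..<N})"
      unfolding g_def by (rule sum_squared_le_sum_of_squares)
    also have "\<dots> \<le> (\<Sum>l<N. 2 * (x n - x l)\<^sup>2 + 2 * \<Delta>\<^sup>2) * real (card {..<N})"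
    proof (intro mult_right_mono sum_mono)
      fix l assume l: "l \<in> {..<N}"
      have "(a n l)\<^sup>2 \<le> 1" using a by (simp add: power_le_one)
      then have "(a n l * (x n - x l - e n l))\<^sup>2 \<le> (x n - x l - e n l)\<^sup>2"
        by (simp add: power_mult_distrib mult_left_le_one_le)
      also have "\<dots> \<le> 2 * (x n - x l)\<^sup>2 + 2 * (e n l)\<^sup>2" by (rule sq)
      also have "(e n l)\<^sup>2 \<le> \<Delta>\<^sup>2"
        using e[of n l] n l by (simp add: abs_le_square_iff[symmetric])
      finally show "(a n l * (x n - x l - e n l))\<^sup>2 \<le> 2 * (x n - x l)\<^sup>2 + 2 * \<Delta>\<^sup>2" by simp
    qed auto
    also have "\<dots> = 2 * real N * (\<Sum>l<N. (x n - x l)\<^sup>2) + 2 * (real N)\<^sup>2 * \<Delta>\<^sup>2"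
      by (simp add: sum.distrib sum_distrib_left[symmetric]) (simp add: power2_eq_square[of "real N"] algebra_simps)
    finally show ?thesis .
  qed
  have "spread N g \<le> (\<Sum>n<N. \<Sum>l<N. 2 * (g n)\<^sup>2 + 2 * (g l)\<^sup>2)"
    unfolding spread_def by (intro sum_mono sq)
  also have "\<dots> = 4 * real N * (\<Sum>n<N. (g n)\<^sup>2)"
    by (simp add: sum.distrib sum_distrib_left mult.assoc)
  also have "\<dots> \<le> 4 * real N * (\<Sum>n<N. 2 * real N * (\<Sum>l<N. (x n - x l)\<^sup>2) + 2 * (real N)\<^sup>2 * \<Delta>\<^sup>2)"
    by (intro mult_left_mono sum_mono gn) auto
  also have "\<dots> = 8 * (real N)\<^sup>2 * spread N x + 8 * (real N)^4 * \<Delta>\<^sup>2"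
    by (simp add: sum.distrib sum_distrib_left[symmetric] spread_def power2_eq_square power4_eq_xxxx algebra_simps)
  finally have "\<alpha>\<^sup>2 * spread N g \<le> \<alpha>\<^sup>2 * (8 * (real N)\<^sup>2 * spread N x + 8 * (real N)^4 * \<Delta>\<^sup>2)"
    by (rule mult_left_mono) simp
  then show ?thesis
    unfolding expand drift z_def by (simp add: algebra_simps)
qed

lemma (in prob_space) expectation_double_sum:
  fixes f :: "nat \<Rightarrow> nat \<Rightarrow> 'a \<Rightarrow> real"
  assumes "\<And>n l. n < N \<Longrightarrow> l < N \<Longrightarrow> integrable M (f n l)"
  shows "expectation (\<lambda>w. \<Sum>n<N. \<Sum>l<N. f n l w) = (\<Sum>n<N. \<Sum>l<N. expectation (f n l))"
proof -
  have "expectation (\<lambda>w. \<Sum>n<N. \<Sum>l<N. f n l w) = (\<Sum>n<N. expectation (\<lambda>w. \<Sum>l<N. f n l w))"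
    by (intro Bochner_Integration.integral_sum Bochner_Integration.integrable_sum assms; simp only: lessThan_iff)
  also have "\<dots> = (\<Sum>n<N. \<Sum>l<N. expectation (f n l))"
    by (intro sum.cong refl Bochner_Integration.integral_sum assms; simp only: lessThan_iff)
  finally show ?thesis .
qed

locale quantized_consensus = prob_space M
  for M :: "'w measure" +
  fixes N :: nat and \<Delta> :: real and \<alpha> :: "nat \<Rightarrow> real"
    and A :: "nat \<Rightarrow> 'w \<Rightarrow> nat \<Rightarrow> nat \<Rightarrow> bool"
    and \<nu> :: "nat \<Rightarrow> 'w \<Rightarrow> nat \<Rightarrow> nat \<Rightarrow> real"
    and x0 :: "nat \<Rightarrow> real"
  assumes N: "N \<ge> 2"
    and graph_sym: "\<And>i w n l. A i w n l = A i w l n"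
    and graph_rv: "\<And>i. A i \<in> measurable M (count_space UNIV)"
    and graph_indep: "indep_vars (\<lambda>_. count_space UNIV) A UNIV"
    and graph_ident: "\<And>i. distr M (count_space UNIV) (A i) = distr M (count_space UNIV) (A 0)"
    and lambda2_pos: "lambda2 (mat N N (\<lambda>(n, l). expectation (\<lambda>w. laplacian_entry N (A 0 w) n l))) > 0"
    and \<Delta>: "\<Delta> > 0"
    and dither_rv: "\<And>i n l. n < N \<Longrightarrow> l < N \<Longrightarrow> (\<lambda>w. \<nu> i w n l) \<in> borel_measurable M"
    and dither_unif: "\<And>i n l. n < N \<Longrightarrow> l < N \<Longrightarrow>
           distr M borel (\<lambda>w. \<nu> i w n l) = uniform_measure lborel {-\<Delta>/2..<\<Delta>/2}"
    and dither_indep: "indep_vars (\<lambda>_. borel) (\<lambda>(i, n, l) w. \<nu> i w n l)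
           {(i, n, l). n < N \<and> l < N}"
    and dither_graph_indep: "indep_set
           (sets (vimage_algebra (space M) (\<lambda>w i. A i w) (Pi\<^sub>M UNIV (\<lambda>_. count_space UNIV))))
           (sets (vimage_algebra (space M)
              (\<lambda>w. \<lambda>k\<in>{(i, n, l). n < N \<and> l < N}. (case k of (i, n, l) \<Rightarrow> \<nu> i w n l))
              (Pi\<^sub>M {(i, n, l). n < N \<and> l < N} (\<lambda>_. borel))))"
    and alpha_pos: "\<And>i. \<alpha> i > 0"
    and alpha_not_summable: "\<not> summable \<alpha>"
    and alpha_sq_summable: "summable (\<lambda>i. (\<alpha> i)\<^sup>2)"
begin

abbreviation X :: "nat \<Rightarrow> 'w \<Rightarrow> nat \<Rightarrow> real" where
  "X i w \<equiv> qc_state N \<Delta> \<alpha> A \<nu> x0 i w"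

definition link :: "nat \<Rightarrow> 'w \<Rightarrow> nat \<Rightarrow> nat \<Rightarrow> real" where
  "link i w n l = of_bool (A i w n l)"

text \<open>Dither and quantization error combined. For a given state this is a function of the
  single fresh variable \<open>\<nu> i w n l\<close>, so one centring argument covers both.\<close>

definition err :: "nat \<Rightarrow> 'w \<Rightarrow> nat \<Rightarrow> nat \<Rightarrow> real" where
  "err i w n l = quant \<Delta> (X i w l + \<nu> i w n l) - X i w l"

definition link_prob :: "nat \<Rightarrow> nat \<Rightarrow> real" where
  "link_prob n l = expectation (\<lambda>w. link 0 w n l)"

section \<open>Independent sources of randomness and the filtration\<close>

text \<open>The whole graph at a time is one source \<open>Inl i\<close>, because links failing at
  the same time may be correlated; each dither variable is a source \<open>Inr (i, n, l)\<close> of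
  its own.\<close>

definition source_events :: "nat + nat \<times> nat \<times> nat \<Rightarrow> 'w set set" where
  "source_events = case_sum (\<lambda>i. {A i -` S \<inter> space M |S. S \<in> sets (count_space UNIV)})
     (\<lambda>k. {(\<lambda>(i, n, l) w. \<nu> i w n l) k -` S \<inter> space M |S. S \<in> sets borel})"

definition sources :: "(nat + nat \<times> nat \<times> nat) set" where
  "sources = UNIV <+> {(i, n, l). n < N \<and> l < N}"

definition generated :: "(nat + nat \<times> nat \<times> nat) set \<Rightarrow> 'w measure" where
  "generated J = sigma (space M) (\<Union>k\<in>J. source_events k)"

text \<open>Times strictly below \<open>i\<close>: the state \<open>X i\<close> is determined by
  them, while the graph and the dithers of time \<open>i\<close> are still fresh.\<close>

definition past :: "nat \<Rightarrow> (nat + nat \<times> nat \<times> nat) set" where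
  "past i = {..<i} <+> {(j, n, l). j < i \<and> n < N \<and> l < N}"

lemma past_sources: "past i \<subseteq> sources"
  by (auto simp: past_def sources_def)

lemma past_mono: "past i \<subseteq> past (Suc i)"
  by (auto simp: past_def)

text \<open>Graphs and dithers are each independent among themselves, and the sigma-algebras of the
  two whole families are independent of each other. Each source is a coordinate projection, hence
  measurable for its family.\<close>

lemma indep_source_events: "indep_sets source_events sources"
  unfolding source_events_def sources_def
proof (rule indep_sets_Plus[OF _ _ dither_graph_indep])
  show "indep_sets (\<lambda>i. {A i -` S \<inter> space M |S. S \<in> sets (count_space UNIV)}) UNIV"
    using graph_indep unfolding indep_vars_def2 by blast
  show "indep_sets (\<lambda>k. {(\<lambda>(i, n, l) w. \<nu> i w n l) k -` S \<inter> space M |S. S \<in> sets borel})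
      {(i, n, l). n < N \<and> l < N}"
    using dither_indep unfolding indep_vars_def2 by blast
  let ?Y = "vimage_algebra (space M) (\<lambda>w i. A i w) (Pi\<^sub>M UNIV (\<lambda>_. count_space UNIV))"
  show "{A i -` S \<inter> space M |S. S \<in> sets (count_space UNIV)} \<subseteq> sets ?Y" for i
  proof -
    have "(\<lambda>w i. A i w) \<in> measurable ?Y (Pi\<^sub>M UNIV (\<lambda>_. count_space UNIV))"
      by (intro measurable_vimage_algebra1) (auto simp: space_PiM)
    from measurable_compose[OF this measurable_component_singleton[of i]]
    have "A i \<in> measurable ?Y (count_space UNIV)" by simp
    from measurable_sets[OF this] show ?thesis by auto
  qed
  let ?K = "{(i, n, l). n < N \<and> l < N} :: (nat \<times> nat \<times> nat) set"
  let ?f = "\<lambda>w. \<lambda>k\<in>?K. (case k of (i, n, l) \<Rightarrow> \<nu> i w n l)"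
  let ?Z = "vimage_algebra (space M) ?f (Pi\<^sub>M ?K (\<lambda>_. borel))"
  show "{(\<lambda>(i, n, l) w. \<nu> i w n l) k -` S \<inter> space M |S. S \<in> sets borel} \<subseteq> sets ?Z"
    if "k \<in> ?K" for k
  proof -
    have "?f \<in> measurable ?Z (Pi\<^sub>M ?K (\<lambda>_. borel))"
      by (intro measurable_vimage_algebra1) (auto simp: space_PiM)
    from measurable_compose[OF this measurable_component_singleton[OF that]]
    have "(\<lambda>(i, n, l) w. \<nu> i w n l) k \<in> measurable ?Z borel"
      using that by (simp add: split_beta')
    from measurable_sets[OF this] show ?thesis by auto
  qed
qed auto

lemma source_events_subset: "k \<in> sources \<Longrightarrow> source_events k \<subseteq> events"
  using indep_source_events unfolding indep_sets_def by blast

lemma Int_stable_source_events: "Int_stable (source_events k)"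
proof -
  have *: "Int_stable {f -` S \<inter> space M |S. S \<in> sets R}" for R :: "'b measure" and f
    unfolding Int_stable_def
  proof safe
    fix S T assume "S \<in> sets R" "T \<in> sets R"
    then show "\<exists>U. (f -` S \<inter> space M) \<inter> (f -` T \<inter> space M) = f -` U \<inter> space M \<and> U \<in> sets R"
      by (intro exI[of _ "S \<inter> T"]) auto
  qed
  show ?thesis unfolding source_events_def by (cases k) (simp_all only: sum.case *)
qed

lemma source_events_Pow: "source_events k \<subseteq> Pow (space M)"
  unfolding source_events_def by (cases k) auto

lemma sets_generated: "sets (generated J) = sigma_sets (space M) (\<Union>k\<in>J. source_events k)"
  unfolding generated_def using source_events_Pow by (intro sets_measure_of) blast

lemma space_generated: "space (generated J) = space M"
  unfolding generated_def using source_events_Pow by (intro space_measure_of) blast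

lemma subalgebra_generated:
  assumes "J \<subseteq> sources" shows "subalgebra M (generated J)"
  unfolding subalgebra_def sets_generated space_generated
  using assms source_events_subset by (auto intro!: sets.sigma_sets_subset)

lemma sets_generated_mono: "J \<subseteq> J' \<Longrightarrow> sets (generated J) \<subseteq> sets (generated J')"
  unfolding sets_generated by (intro sigma_sets_mono') auto

lemma measurable_generated_mono:
  "J \<subseteq> J' \<Longrightarrow> f \<in> measurable (generated J) R \<Longrightarrow> f \<in> measurable (generated J') R"
  using measurable_mono[OF order_refl refl sets_generated_mono, of J J' R]
  by (auto simp: space_generated)

lemma indep_generated:
  assumes "J \<subseteq> sources" "J' \<subseteq> sources" "J \<inter> J' = {}"
  shows "indep_set (sets (generated J)) (sets (generated J'))"
  unfolding sets_generated
  by (intro indep_set_sigma_sets_Union[OF indep_source_events Int_stable_source_events] assms)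

lemma graph_generated:
  assumes "Inl i \<in> J" shows "A i \<in> measurable (generated J) (count_space UNIV)"
proof (rule measurableI)
  fix S :: "(nat \<Rightarrow> nat \<Rightarrow> bool) set"
  have "A i -` S \<inter> space M \<in> source_events (Inl i)"
    by (auto simp: source_events_def)
  then show "A i -` S \<inter> space (generated J) \<in> sets (generated J)"
    unfolding sets_generated space_generated using assms by (intro sigma_sets.Basic) blast
qed auto

lemma dither_generated:
  assumes "Inr (i, n, l) \<in> J" shows "(\<lambda>w. \<nu> i w n l) \<in> borel_measurable (generated J)"
proof (rule measurableI)
  fix S :: "real set" assume "S \<in> sets borel"
  then have "(\<lambda>w. \<nu> i w n l) -` S \<inter> space M \<in> source_events (Inr (i, n, l))"
    by (auto simp: source_events_def)
  then show "(\<lambda>w. \<nu> i w n l) -` S \<inter> space (generated J) \<in> sets (generated J)"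
    unfolding sets_generated space_generated using assms by (intro sigma_sets.Basic) blast
qed auto

lemma link_generated:
  assumes "Inl i \<in> J" shows "(\<lambda>w. link i w n l) \<in> borel_measurable (generated J)"
  unfolding link_def
  using measurable_compose[OF graph_generated[OF assms], of "\<lambda>g. of_bool (g n l) :: real" borel] by simp

section \<open>The recursion in perturbation form, its measurability and its bounds\<close>

lemma degree_eq_sum: "degree_g N g n = (\<Sum>l<N. of_bool (g n l))"
proof -
  have "(\<Sum>l<N. of_bool (g n l)) = (\<Sum>l\<in>{l. l < N \<and> g n l}. 1 :: real)"
    by (intro sum.mono_neutral_cong_right) auto
  then show ?thesis by (simp add: degree_g_def)
qed

text \<open>Distributing the degree term over the neighbours gives the update that
  \<open>spread_step\<close> expects, with \<open>link\<close> as weights and \<open>err\<close> as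
  perturbation.\<close>

lemma X_Suc:
  "X (Suc i) w n = X i w n - \<alpha> i * (\<Sum>l<N. link i w n l * (X i w n - X i w l - err i w n l))"
proof -
  have "(\<Sum>l\<in>{l. l < N \<and> A i w n l}. quant \<Delta> (X i w l + \<nu> i w n l))
      = (\<Sum>l<N. link i w n l * (X i w l + err i w n l))"
    by (intro sum.mono_neutral_cong_left) (auto simp: link_def err_def)
  moreover have "degree_g N (A i w) n * X i w n = (\<Sum>l<N. link i w n l * X i w n)"
    by (simp add: degree_eq_sum link_def sum_distrib_right)
  ultimately show ?thesis
    by (simp add: sum_subtractf sum.distrib algebra_simps)
qed

lemma X_past: "n < N \<Longrightarrow> (\<lambda>w. X i w n) \<in> borel_measurable (generated (past i))"
proof (induction i arbitrary: n)
  case (Suc i)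
  have X: "(\<lambda>w. X i w k) \<in> borel_measurable (generated (past (Suc i)))" if "k < N" for k
    using Suc.IH[OF that] past_mono by (rule measurable_generated_mono[rotated])
  have [measurable]: "(\<lambda>w. link i w n k) \<in> borel_measurable (generated (past (Suc i)))" for k
    by (rule link_generated) (auto simp: past_def)
  have V: "(\<lambda>w. \<nu> i w n k) \<in> borel_measurable (generated (past (Suc i)))" if "k < N" for k
    using that Suc.prems by (intro dither_generated) (auto simp: past_def)
  have "(\<lambda>w. err i w n k) \<in> borel_measurable (generated (past (Suc i)))" if "k < N" for k
    unfolding err_def using X[OF that] V[OF that] by measurable
  then show ?case
    unfolding X_Suc using X Suc.prems
    by (intro borel_measurable_diff borel_measurable_times borel_measurable_sum) auto
qed simp

lemma generated_measurable:
  assumes "J \<subseteq> sources" "f \<in> measurable (generated J) R" shows "f \<in> measurable M R"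
  using measurable_from_subalg[OF subalgebra_generated[OF assms(1)] assms(2)] .

lemma link_meas [measurable]: "(\<lambda>w. link i w n l) \<in> borel_measurable M"
  by (rule generated_measurable[OF _ link_generated[of i sources]]) (auto simp: sources_def)

lemma err_meas: "n < N \<Longrightarrow> l < N \<Longrightarrow> (\<lambda>w. err i w n l) \<in> borel_measurable M"
  unfolding err_def using generated_measurable[OF past_sources X_past, of l i] dither_rv[of n l i]
  by measurable

lemma link_bounded: "ess_bounded (\<lambda>w. link i w n l)"
  using link_meas by (rule ess_boundedI[of _ 1]) (simp add: link_def)

text \<open>One half of \<open>\<Delta>\<close> comes from rounding, the other from the dither
  itself.\<close>

lemma err_bound: "AE w in M. \<forall>n<N. \<forall>l<N. \<bar>err i w n l\<bar> \<le> \<Delta>"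
proof -
  have "AE w in M. n < N \<longrightarrow> l < N \<longrightarrow> \<bar>err i w n l\<bar> \<le> \<Delta>" for n l
  proof (cases "n < N \<and> l < N")
    case True
    have "AE u in distr M borel (\<lambda>w. \<nu> i w n l). u \<in> {-\<Delta>/2..<\<Delta>/2}"
      using True by (subst dither_unif) (auto intro: AE_uniform_measureI)
    then have "AE w in M. \<nu> i w n l \<in> {-\<Delta>/2..<\<Delta>/2}"
      using True dither_rv[of n l i] by (subst (asm) AE_distr_iff) auto
    then show ?thesis
    proof eventually_elim
      case (elim w)
      then show ?case
        using quant_error[OF \<Delta>, of "X i w l + \<nu> i w n l"] unfolding err_def atLeastLessThan_iff
        by linarith
    qed
  qed auto
  then have "AE w in M. \<forall>n l. n < N \<longrightarrow> l < N \<longrightarrow> \<bar>err i w n l\<bar> \<le> \<Delta>"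
    unfolding AE_all_countable by blast
  then show ?thesis by eventually_elim blast
qed

lemma err_bounded: "n < N \<Longrightarrow> l < N \<Longrightarrow> ess_bounded (\<lambda>w. err i w n l)"
  using err_bound[of i] err_meas[of n l i] unfolding ess_bounded_def
  by (auto intro!: exI[of _ \<Delta>] elim: eventually_mono)

text \<open>The bound may grow with \<open>i\<close>; only integrability at each fixed time is drawn
  from it.\<close>

lemma X_bounded: "n < N \<Longrightarrow> ess_bounded (\<lambda>w. X i w n)"
proof (induction i arbitrary: n)
  case (Suc i)
  then show ?case unfolding X_Suc
    by (intro ess_bounded_intros link_bounded err_bounded) auto
qed (simp add: ess_bounded_const)

lemma spread_bounded: "ess_bounded (\<lambda>w. spread N (X i w))"
  unfolding spread_def by (intro ess_bounded_intros X_bounded) auto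

lemma spread_past: "(\<lambda>w. spread N (X i w)) \<in> borel_measurable (generated (past i))"
  unfolding spread_def
  by (intro borel_measurable_sum borel_measurable_power borel_measurable_diff X_past) auto

section \<open>Conditional means of errors and links\<close>

lemma expectation_err_zero:
  assumes B: "B \<in> sets (generated (past i))" and nl: "n < N" "l < N"
  shows "expectation (\<lambda>w. (\<Sum>k<N. X i w n - X i w k) * link i w n l * err i w n l * indicator B w) = 0"
proof -
  \<comment> \<open>The current graph is frozen together with the past, since \<open>link i\<close>
    multiplies the error; the one dither variable \<open>\<nu> i w n l\<close> forms the other
    side.\<close>
  let ?J = "insert (Inl i) (past i)" and ?J' = "{Inr (i, n, l)}"
  define Y where "Y w = (\<Sum>k<N. X i w n - X i w k) * link i w n l * indicator B w" for w
  have J: "?J \<subseteq> sources" "?J' \<subseteq> sources" "?J \<inter> ?J' = {}"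
    using past_sources nl by (auto simp: sources_def past_def)
  have X: "(\<lambda>w. X i w k) \<in> borel_measurable (generated ?J)" if "k < N" for k
    by (rule measurable_generated_mono[OF _ X_past[OF that]]) auto
  have "B \<in> sets (generated ?J)" using B sets_generated_mono[of "past i" ?J] by auto
  then have Y: "Y \<in> borel_measurable (generated ?J)"
    unfolding Y_def using X nl
    by (intro borel_measurable_times borel_measurable_sum borel_measurable_diff
        borel_measurable_indicator link_generated) auto
  have Bev: "B \<in> events" using B subalgebra_generated[OF past_sources] by (auto simp: subalgebra_def)
  have "expectation (\<lambda>w. Y w * (quant \<Delta> (X i w l + \<nu> i w n l) - X i w l)) = 0"
  proof (rule expectation_indep_kernel_zero[OF indep_generated[OF J] subalgebra_generated[OF J(1)]
        subalgebra_generated[OF J(2)] Y X[OF nl(2)], where h = "\<lambda>x u. quant \<Delta> (x + u) - x"])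
    show "(\<lambda>w. \<nu> i w n l) \<in> borel_measurable (generated {Inr (i, n, l)})"
      by (rule dither_generated) simp
    show "(\<lambda>(x, u). quant \<Delta> (x + u) - x) \<in> borel_measurable (borel \<Otimes>\<^sub>M borel)" by measurable
    have "ess_bounded (\<lambda>w. Y w * err i w n l)"
      unfolding Y_def using nl Bev by (intro ess_bounded_intros X_bounded link_bounded err_bounded) auto
    then show "integrable M (\<lambda>w. Y w * (quant \<Delta> (X i w l + \<nu> i w n l) - X i w l))"
      unfolding err_def by (rule ess_bounded_integrable)
    show "(\<integral>u. quant \<Delta> (x + u) - x \<partial>distr M borel (\<lambda>w. \<nu> i w n l)) = 0" for x
      unfolding dither_unif[OF nl] by (rule quant_dither_unbiased[OF \<Delta>])
  qed
  then show ?thesis by (simp add: Y_def err_def mult_ac)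
qed

lemma expectation_link: "expectation (\<lambda>w. link i w n l) = link_prob n l"
proof -
  have "expectation (\<lambda>w. link i w n l) = (\<integral>g. of_bool (g n l) \<partial>distr M (count_space UNIV) (A i))" for i
    using graph_rv[of i] by (subst integral_distr) (auto simp: link_def)
  then show ?thesis unfolding link_prob_def by (metis graph_ident)
qed

text \<open>The graph at time \<open>i\<close> is independent of the past, which determines the
  state. Each link is averaged separately, so correlations between links of the same graph do not
  enter.\<close>

lemma expectation_link_mult:
  assumes B: "B \<in> sets (generated (past i))" and nl: "n < N" "l < N"
  shows "expectation (\<lambda>w. link i w n l * (X i w n - X i w l)\<^sup>2 * indicator B w)
    = link_prob n l * expectation (\<lambda>w. (X i w n - X i w l)\<^sup>2 * indicator B w)"
proof -
  let ?Y = "\<lambda>w. (X i w n - X i w l)\<^sup>2 * indicator B w"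
  have J: "{Inl i} \<subseteq> sources" "past i \<subseteq> sources" "{Inl i} \<inter> past i = {}"
    using past_sources by (auto simp: sources_def past_def)
  have Bev: "B \<in> events" using B subalgebra_generated[OF past_sources] by (auto simp: subalgebra_def)
  have "?Y \<in> borel_measurable (generated (past i))"
    using B nl by (intro borel_measurable_times borel_measurable_power borel_measurable_diff
        borel_measurable_indicator X_past) auto
  then have "indep_var borel (\<lambda>w. link i w n l) borel ?Y"
    by (intro indep_var_of_subalgebras[OF indep_generated[OF J] subalgebra_generated[OF J(1)]
          subalgebra_generated[OF J(2)]] link_generated) auto
  moreover have "integrable M ?Y" "integrable M (\<lambda>w. link i w n l)"
    using nl Bev by (auto intro!: ess_bounded_integrable ess_bounded_intros X_bounded link_bounded)
  ultimately have "expectation (\<lambda>w. link i w n l * ?Y w) = expectation (\<lambda>w. link i w n l) * expectation ?Y"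
    by (intro indep_var_lebesgue_integral)
  then show ?thesis by (simp add: expectation_link mult.assoc)
qed

section \<open>The mean graph and its cuts\<close>

lemma link_prob_nonneg: "0 \<le> link_prob n l"
  unfolding link_prob_def by (rule integral_nonneg_AE) (auto simp: link_def)

lemma link_prob_sym: "link_prob n l = link_prob l n"
  unfolding link_prob_def link_def graph_sym[of _ _ n l] ..

lemma mean_laplacian_entry:
  "expectation (\<lambda>w. laplacian_entry N (A 0 w) n l) = (if n = l then \<Sum>k<N. link_prob n k else 0) - link_prob n l"
proof -
  have int: "integrable M (\<lambda>w. link 0 w a b)" for a b
    by (rule ess_bounded_integrable[OF link_bounded])
  have "laplacian_entry N (A 0 w) n l = (if n = l then \<Sum>k<N. link 0 w n k else 0) - link 0 w n l" for w
    by (simp add: laplacian_entry_def degree_eq_sum link_def)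
  then show ?thesis using int unfolding link_prob_def by (cases "n = l") auto
qed

lemma link_prob_no_cut:
  assumes T: "T \<subseteq> {..<N}" "T \<noteq> {}" "T \<noteq> {..<N}"
  shows "\<exists>n\<in>T. \<exists>l\<in>{..<N} - T. link_prob n l \<noteq> 0"
proof (rule ccontr)
  assume "\<not> ?thesis"
  then have cut: "link_prob n l = 0" if "n \<in> T" "l \<in> {..<N} - T" for n l
    using that by blast
  then have cut': "link_prob n l = 0" if "l \<in> T" "n \<in> {..<N} - T" for n l
    using that link_prob_sym by metis
  define L where "L = mat N N (\<lambda>(n, l). expectation (\<lambda>w. laplacian_entry N (A 0 w) n l))"
  have L: "L \<in> carrier_mat N N" by (simp add: L_def)
  obtain s where s: "s \<in> T" using T by blast
  obtain t where t: "t < N" "t \<notin> T" using T by blast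
  have split: "(\<Sum>c\<in>S. L $$ (r, c)) = (if r \<in> S then \<Sum>k<N. link_prob r k else 0) - (\<Sum>c\<in>S. link_prob r c)"
    if "r < N" "S \<subseteq> {..<N}" for r S
  proof -
    have "(\<Sum>c\<in>S. L $$ (r, c)) = (\<Sum>c\<in>S. (if r = c then \<Sum>k<N. link_prob r k else 0) - link_prob r c)"
      using that by (intro sum.cong) (auto simp: L_def mean_laplacian_entry)
    then show ?thesis using finite_subset[OF that(2)] by (simp add: sum_subtractf)
  qed
  \<comment> \<open>For \<open>r\<close> in \<open>S\<close> all links of \<open>r\<close> with
    positive probability end in \<open>S\<close>, so the diagonal entry cancels the others; for
    \<open>r\<close> outside \<open>S\<close> every entry in the columns of \<open>S\<close> is
    0.\<close>
  have zero: "(\<Sum>c\<in>S. L $$ (r, c)) = 0"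
    if r: "r < N" and S: "S \<subseteq> {..<N}"
      and out: "r \<in> S \<Longrightarrow> \<forall>k\<in>{..<N} - S. link_prob r k = 0"
      and into: "r \<notin> S \<Longrightarrow> \<forall>k\<in>S. link_prob r k = 0" for r S
  proof (cases "r \<in> S")
    case True
    then have "(\<Sum>k<N. link_prob r k) = (\<Sum>c\<in>S. link_prob r c)"
      using out S by (intro sum.mono_neutral_right) auto
    then show ?thesis using True split[OF r S] by simp
  next
    case False
    then show ?thesis using into split[OF r S] by simp
  qed
  have "[:0, 1:]\<^sup>2 dvd char_poly L"
  proof (rule sq_dvd_char_poly_of_split_kernel[OF L T(1) s t])
    show "(\<Sum>c\<in>T. L $$ (r, c)) = 0" if "r < N" for r
      by (rule zero[OF that T(1)]) (use cut cut' that in auto)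
    show "(\<Sum>c\<in>{..<N} - T. L $$ (r, c)) = 0" if "r < N" for r
      by (rule zero[OF that]) (use cut cut' that in auto)
  qed
  then show False using lambda2_le_zero[OF L] lambda2_pos by (simp add: L_def)
qed

text \<open>Multiplying \<open>spread_step\<close> by the indicator of a past event and integrating
  gives the recursion required by \<open>robbins_siegmund_tendsto_zero\<close>, with
  \<open>c\<close> from the Poincare inequality and the other constants from
  \<open>spread_step\<close>.\<close>

lemma spread_tendsto_zero: "AE w in M. (\<lambda>i. spread N (X i w)) \<longlonglongrightarrow> 0"
proof -
  obtain c where c: "0 < c"
      "\<And>x. c * spread N x \<le> (\<Sum>n<N. \<Sum>l<N. link_prob n l * (x n - x l)\<^sup>2)"
    using no_cut_poincare[of link_prob N, OF link_prob_nonneg link_prob_no_cut] N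
    unfolding spread_def by auto
  show ?thesis
  proof (rule robbins_siegmund_tendsto_zero[where F = "\<lambda>i. generated (past i)" and \<alpha> = \<alpha>
        and a = "2 * real N * c" and b = "8 * (real N)\<^sup>2" and d = "8 * (real N)^4 * \<Delta>\<^sup>2"])
    fix i B assume B: "B \<in> sets (generated (past i))"
    have Bev: "B \<in> events" using B subalgebra_generated[OF past_sources] by (auto simp: subalgebra_def)
    let ?I = "indicator B :: 'w \<Rightarrow> real"
    let ?z = "\<lambda>w n. \<Sum>k<N. X i w n - X i w k"
    define C where "C = 1 + 8 * (real N)\<^sup>2 * (\<alpha> i)\<^sup>2"
    define D where "D = 8 * (real N)^4 * \<Delta>\<^sup>2 * (\<alpha> i)\<^sup>2"
    define S1 where "S1 w = spread N (X i w) * ?I w" for w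
    define S2 where "S2 w = (\<Sum>n<N. \<Sum>l<N. link i w n l * (X i w n - X i w l)\<^sup>2 * ?I w)" for w
    define S3 where "S3 w = (\<Sum>n<N. \<Sum>l<N. ?z w n * link i w n l * err i w n l * ?I w)" for w
    \<comment> \<open>The right-hand side of \<open>spread_step\<close> restricted to
      \<open>B\<close>: \<open>S2\<close> carries the drift and \<open>S3\<close> the term linear in
      the error.\<close>
    define R where "R w = C * S1 w - 2 * \<alpha> i * real N * S2 w + 4 * \<alpha> i * S3 w + D * ?I w" for w
    have int1: "integrable M S1"
      unfolding S1_def using Bev by (intro ess_bounded_integrable ess_bounded_intros spread_bounded) auto
    have int2: "integrable M (\<lambda>w. link i w n l * (X i w n - X i w l)\<^sup>2 * ?I w)" if "n < N" "l < N" for n l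
      using Bev that by (intro ess_bounded_integrable ess_bounded_intros X_bounded link_bounded) auto
    have int3: "integrable M (\<lambda>w. ?z w n * link i w n l * err i w n l * ?I w)" if "n < N" "l < N" for n l
      using Bev that
      by (intro ess_bounded_integrable ess_bounded_intros X_bounded link_bounded err_bounded) auto
    have int4: "integrable M (\<lambda>w. (X i w n - X i w l)\<^sup>2 * ?I w)" if "n < N" "l < N" for n l
      using Bev that by (intro ess_bounded_integrable ess_bounded_intros X_bounded) auto
    have intI: "integrable M ?I"
      using Bev by (intro ess_bounded_integrable ess_bounded_indicator)
    have intS: "integrable M S2" "integrable M S3"
      unfolding S2_def S3_def
      by (intro Bochner_Integration.integrable_sum int2 int3; simp)+
    have intR: "integrable M R"
      unfolding R_def using int1 intS intI
      by (intro Bochner_Integration.integrable_add Bochner_Integration.integrable_diff integrable_mult_right)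
    have "expectation (\<lambda>w. spread N (X (Suc i) w) * ?I w) \<le> expectation R"
    proof (rule integral_mono_AE[OF _ intR])
      show "integrable M (\<lambda>w. spread N (X (Suc i) w) * ?I w)"
        using Bev by (intro ess_bounded_integrable ess_bounded_intros spread_bounded) auto
      show "AE w in M. spread N (X (Suc i) w) * ?I w \<le> R w"
        using err_bound[of i]
      proof eventually_elim
        case (elim w)
        have "spread N (X (Suc i) w) \<le> C * spread N (X i w)
            - 2 * \<alpha> i * real N * (\<Sum>n<N. \<Sum>l<N. link i w n l * (X i w n - X i w l)\<^sup>2)
            + 4 * \<alpha> i * (\<Sum>n<N. \<Sum>l<N. ?z w n * link i w n l * err i w n l) + D"
          unfolding C_def D_def
        proof (rule spread_step[OF _ _ _ _ X_Suc])
          show "link i w n l = link i w l n" for n l using graph_sym by (simp add: link_def)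
          show "\<bar>err i w n l\<bar> \<le> \<Delta>" if "n < N" "l < N" for n l using elim that by blast
        qed (auto simp: link_def)
        then show ?case unfolding R_def S1_def S2_def S3_def by (cases "w \<in> B") auto
      qed
    qed
    also have "expectation R = C * expectation S1 - 2 * \<alpha> i * real N * expectation S2
        + 4 * \<alpha> i * expectation S3 + D * prob B"
      unfolding R_def using int1 intS intI Bev by simp
    also have "expectation S3 = 0"
    proof -
      have "expectation S3 = (\<Sum>n<N. \<Sum>l<N. expectation (\<lambda>w. ?z w n * link i w n l * err i w n l * ?I w))"
        unfolding S3_def by (rule expectation_double_sum) (rule int3)
      also have "\<dots> = 0"
        by (intro sum.neutral ballI expectation_err_zero[OF B]; simp only: lessThan_iff)
      finally show ?thesis .
    qed
    also have "C * expectation S1 - 2 * \<alpha> i * real N * expectation S2 + 4 * \<alpha> i * 0 + D * prob B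
        \<le> C * expectation S1 - 2 * \<alpha> i * real N * (c * expectation S1) + D * prob B"
    proof -
      \<comment> \<open>The Poincare inequality holds pathwise at the state \<open>X i w\<close>
        with link probabilities as weights; under the expectation, independence of the current graph
        from the past replaces each probability by the actual link.\<close>
      have "c * expectation S1 = expectation (\<lambda>w. c * S1 w)" by simp
      also have "\<dots> \<le> expectation (\<lambda>w. \<Sum>n<N. \<Sum>l<N. link_prob n l * ((X i w n - X i w l)\<^sup>2 * ?I w))"
      proof (rule integral_mono)
        show "integrable M (\<lambda>w. \<Sum>n<N. \<Sum>l<N. link_prob n l * ((X i w n - X i w l)\<^sup>2 * ?I w))"
          by (intro Bochner_Integration.integrable_sum integrable_mult_right int4; simp)
        show "c * S1 w \<le> (\<Sum>n<N. \<Sum>l<N. link_prob n l * ((X i w n - X i w l)\<^sup>2 * ?I w))"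
          for w using c(2)[of "X i w"] unfolding S1_def by (cases "w \<in> B") auto
      qed (use int1 in auto)
      also have "\<dots> = (\<Sum>n<N. \<Sum>l<N. link_prob n l * expectation (\<lambda>w. (X i w n - X i w l)\<^sup>2 * ?I w))"
        by (subst expectation_double_sum) (simp_all only: integral_mult_right_zero integrable_mult_right int4)
      also have "\<dots> = (\<Sum>n<N. \<Sum>l<N. expectation (\<lambda>w. link i w n l * (X i w n - X i w l)\<^sup>2 * ?I w))"
        by (intro sum.cong refl expectation_link_mult[OF B, symmetric]; simp only: lessThan_iff)
      also have "\<dots> = expectation S2"
        unfolding S2_def by (rule expectation_double_sum[symmetric]) (rule int2)
      finally show ?thesis using alpha_pos[of i] by (simp add: mult_left_mono)
    qed
    also have "\<dots> = (1 - 2 * real N * c * \<alpha> i + 8 * (real N)\<^sup>2 * (\<alpha> i)\<^sup>2) * expectation (\<lambda>w. spread N (X i w) * ?I w)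
        + 8 * (real N)^4 * \<Delta>\<^sup>2 * (\<alpha> i)\<^sup>2 * prob B"
      unfolding C_def D_def S1_def by (simp add: algebra_simps)
    finally show "expectation (\<lambda>w. spread N (X (Suc i) w) * ?I w)
      \<le> (1 - 2 * real N * c * \<alpha> i + 8 * (real N)\<^sup>2 * (\<alpha> i)\<^sup>2) * expectation (\<lambda>w. spread N (X i w) * ?I w)
        + 8 * (real N)^4 * \<Delta>\<^sup>2 * (\<alpha> i)\<^sup>2 * prob B" .
  next
    show "sets (generated (past i)) \<subseteq> sets (generated (past (Suc i)))" for i
      by (rule sets_generated_mono[OF past_mono])
    show "subalgebra M (generated (past i))" for i
      by (rule subalgebra_generated[OF past_sources])
    show "integrable M (\<lambda>w. spread N (X i w))" for i
      by (rule ess_bounded_integrable[OF spread_bounded])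
  qed (use N c(1) alpha_pos alpha_not_summable alpha_sq_summable in
      \<open>auto intro: spread_past spread_nonneg\<close>)
qed

lemma consensus: "AE w in M. (\<lambda>i. dist_consensus N (X i w)) \<longlonglongrightarrow> 0"
  using spread_tendsto_zero
proof eventually_elim
  case (elim w)
  have "(\<lambda>i. sqrt (spread N (X i w))) \<longlonglongrightarrow> 0"
    using tendsto_real_sqrt[OF elim] by simp
  then show ?case
  proof (rule tendsto_sandwich[rotated 3])
    show "\<forall>\<^sub>F i in sequentially. 0 \<le> dist_consensus N (X i w)"
      by (simp add: dist_consensus_nonneg)
    show "\<forall>\<^sub>F i in sequentially. dist_consensus N (X i w) \<le> sqrt (spread N (X i w))"
      using N by (intro always_eventually allI dist_consensus_le_spread) simp
  qed simp
qed

end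

theorem mainTheorem1:
  fixes M :: "'w measure" and N :: nat and \<Delta> :: real
    and \<alpha> :: "nat \<Rightarrow> real"
    and A :: "nat \<Rightarrow> 'w \<Rightarrow> nat \<Rightarrow> nat \<Rightarrow> bool"
    and \<nu> :: "nat \<Rightarrow> 'w \<Rightarrow> nat \<Rightarrow> nat \<Rightarrow> real"
    and x0 :: "nat \<Rightarrow> real"
  assumes "prob_space M"
    and "N \<ge> 2"
    \<comment> \<open>random simple undirected graphs on {0..<N}\<close>
    and graph_sym: "\<And>i w n l. A i w n l = A i w l n"
    and graph_irrefl: "\<And>i w n. \<not> A i w n n"
    and graph_nodes: "\<And>i w n l. A i w n l \<Longrightarrow> n < N \<and> l < N"
    and graph_rv: "\<And>i. A i \<in> measurable M (count_space UNIV)"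
    \<comment> \<open>i.i.d. graph sequence\<close>
    and graph_indep: "prob_space.indep_vars M (\<lambda>_. count_space UNIV) A UNIV"
    and graph_ident: "\<And>i. distr M (count_space UNIV) (A i) = distr M (count_space UNIV) (A 0)"
    \<comment> \<open>lambda_2 of the mean Laplacian is positive\<close>
    and lambda2_pos: "lambda2 (mat N N (\<lambda>(n, l).
           prob_space.expectation M (\<lambda>w. laplacian_entry N (A 0 w) n l))) > 0"
    \<comment> \<open>quantizer step and dither\<close>
    and "\<Delta> > 0"
    and dither_rv: "\<And>i n l. n < N \<Longrightarrow> l < N \<Longrightarrow> (\<lambda>w. \<nu> i w n l) \<in> borel_measurable M"
    and dither_unif: "\<And>i n l. n < N \<Longrightarrow> l < N \<Longrightarrow>
           distr M borel (\<lambda>w. \<nu> i w n l) = uniform_measure lborel {-\<Delta>/2..<\<Delta>/2}"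
    and dither_indep: "prob_space.indep_vars M (\<lambda>_. borel) (\<lambda>(i, n, l) w. \<nu> i w n l)
           {(i, n, l). n < N \<and> l < N}"
    and dither_graph_indep: "prob_space.indep_set M
           (sets (vimage_algebra (space M) (\<lambda>w i. A i w) (Pi\<^sub>M UNIV (\<lambda>_. count_space UNIV))))
           (sets (vimage_algebra (space M)
              (\<lambda>w. \<lambda>k\<in>{(i, n, l). n < N \<and> l < N}. (case k of (i, n, l) \<Rightarrow> \<nu> i w n l))
              (Pi\<^sub>M {(i, n, l). n < N \<and> l < N} (\<lambda>_. borel))))"
    \<comment> \<open>weights\<close>
    and alpha_pos: "\<And>i. \<alpha> i > 0"
    and alpha_not_summable: "\<not> summable \<alpha>"
    and alpha_sq_summable: "summable (\<lambda>i. (\<alpha> i)\<^sup>2)"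
  shows "AE w in M. (\<lambda>i. dist_consensus N (qc_state N \<Delta> \<alpha> A \<nu> x0 i w)) \<longlonglongrightarrow> 0"
proof -
  interpret quantized_consensus M N \<Delta> \<alpha> A \<nu> x0
    using assms by (intro quantized_consensus.intro quantized_consensus_axioms.intro)
  show ?thesis by (rule consensus)
qed

end
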